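(* Assume $\dot x=A(t)x$ has a nonuniform exponential dichotomy on $\mathbb{R}_0^+$ with constants $(K,\alpha,\mu)$ and projector $P(\cdot)$ and nonuniform bounded growth with constants $(K_0,a,\varepsilon)$; assume $f$ satisfies (P1) with $(L_f,\theta)$, (P2) with $(M,\delta)$ and (P3); let $b>0$ be such that $$\delta+\mu<\min\{b,\alpha\};\quad \mu\le\theta,\ \varepsilon<\theta,\ \alpha+\mu-\theta+b>0,\ \alpha-\mu+\theta-b>0;\quad \frac{KL_f}{\alpha+\mu-\theta+b}+\frac{KL_f}{\alpha-\mu+\theta-b}<1.$$ Assume in addition that $$\max\{\mu+\alpha-a,\ \mu-(\alpha-a)\}<\theta,\qquad \mu+\varepsilon\le\theta,$$ $$KL_fK_0e^{\frac{L_fK_0}{\theta-\varepsilon}}\max\Big\{\frac{1}{\theta-(\alpha-a)-\mu},\ \frac{1}{\theta+(\alpha-a)-\mu}\Big\}\le\frac1c$$ for some $c>2$. Then there exists $\tilde t_c\in(0,+\infty]$ such that for every $t\in[0,\tilde t_c)$ the map $\eta\mapsto G(t,\eta)$ is a $C^1$-diffeomorphism of $\mathbb{R}^n$.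
   Context: Standing setting: $A\colon\mathbb{R}_0^+\to M_n(\mathbb{R})$ and $f\colon\mathbb{R}_0^+\times\mathbb{R}^n\to\mathbb{R}^n$ continuous; solutions of $\dot y=A(t)y+f(t,y)$ exist on $\mathbb{R}_0^+$ and are unique; $y(s,t,\eta)$ denotes the solution through $\eta$ at time $t$. $\Phi(t,s)=\Phi(t)\Phi^{-1}(s)$ is the evolution operator of $\dot x=A(t)x$; $|\cdot|$ a norm on $\mathbb{R}^n$, $\|\cdot\|$ induced matrix norm. Nonuniform exponential dichotomy with constants $(K,\alpha,\mu)$: projector $P(\cdot)$, $K\ge1$, $\alpha>0$, $0\le\mu<\alpha$, $P(t)\Phi(t,s)=\Phi(t,s)P(s)$ for all $t,s\ge0$, $\|\Phi(t,s)P(s)\|\le Ke^{-\alpha(t-s)+\mu s}$ for $t\ge s\ge0$, $\|\Phi(t,s)(I-P(s))\|\le Ke^{\alpha(t-s)+\mu s}$ for $0\le t\le s$. Green function $\mathcal{G}(t,s)=\Phi(t,s)P(s)$ for $t\ge s\ge0$, $\mathcal{G}(t,s)=-\Phi(t,s)(I-P(s))$ for $s>t\ge0$. Nonuniform bounded growth $(K_0,a,\varepsilon)$: $K_0\ge1,a>0,\varepsilon\ge0$, $\|\Phi(t,s)\|\le K_0e^{a|t-s|+\varepsilon s}$ for all $t,s\ge0$. (P1): $|f(t,y_1)-f(t,y_2)|\le L_fe^{-\theta t}|y_1-y_2|$, $L_f>0,\theta\ge0$. (P2): $|f(t,y)|\le Me^{\delta t}$, $M>0,\delta\ge0$. (P3):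 $\partial_2 f$ (derivative in the state variable) exists and $f,\partial_2f$ are continuous in $(t,x)$. $G$ is the inverse homeomorphism of the topological conjugacy between $\dot x=A(t)x$ and $\dot y=A(t)y+f(t,y)$ given by $G(t,\eta)=\eta-\int_0^{+\infty}\mathcal{G}(t,s)f(s,y(s,t,\eta))\,ds$. *)

theory Defs
  imports "HOL-Analysis.Analysis" "HOL-Library.Extended_Real"
begin

text \<open>An abstract norm on R^n (the paper allows an arbitrary norm).\<close>
definition is_norm :: "(real^'n \<Rightarrow> real) \<Rightarrow> bool" where
  "is_norm N \<longleftrightarrow> (\<forall>x. N x = 0 \<longleftrightarrow> x = 0) \<and> (\<forall>x y. N (x + y) \<le> N x + N y)
      \<and> (\<forall>c x. N (c *\<^sub>R x) = \<bar>c\<bar> * N x)"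

definition mnorm :: "(real^'n \<Rightarrow> real) \<Rightarrow> real^'n^'n \<Rightarrow> real" where
  "mnorm N B = Sup {N (B *v x) | x. N x = 1}"

definition evol :: "(real \<Rightarrow> real^'n^'n) \<Rightarrow> real \<Rightarrow> real \<Rightarrow> real^'n^'n" where
  "evol X t s = X t ** matrix_inv (X s)"

definition green :: "(real \<Rightarrow> real^'n^'n) \<Rightarrow> (real \<Rightarrow> real^'n^'n) \<Rightarrow> real \<Rightarrow> real \<Rightarrow> real^'n^'n" where
  "green X P t s = (if s \<le> t then evol X t s ** P s else - (evol X t s ** (mat 1 - P s)))"

definition C1_map :: "(real^'n \<Rightarrow> real^'n) \<Rightarrow> bool" where
  "C1_map g \<longleftrightarrow> (\<exists>g' :: real^'n \<Rightarrow> real^'n^'n.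
      (\<forall>x. (g has_derivative (\<lambda>h. g' x *v h)) (at x)) \<and> continuous_on UNIV g')"

definition C1_diffeo :: "(real^'n \<Rightarrow> real^'n) \<Rightarrow> bool" where
  "C1_diffeo g \<longleftrightarrow> bij g \<and> C1_map g \<and> C1_map (inv g)"

end

(*
Write G(t, \<cdot>) = id - \<phi>. Bounded growth, (P1) and Gronwall's inequality show that the flow from time t to time s is
Lipschitz with constant K0 exp(Lf K0 / (\<theta> - \<epsilon>)) exp(\<epsilon> t + a |s - t|). Integrating this against the Green function
bounds the Lipschitz constant of \<phi> by a continuous function of t which at t = 0, where the part of the integral
over s \<le> t vanishes, is at most 1/c < 1. Hence for small t the map id - \<phi> is bijective by Banach's theorem and its
derivative is invertible, as soon as \<phi> is C1.

By dominated differentiation under the integral, \<phi> is C1 if the flow is C1 in the initial value. For the latter,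
put E = (y_x - y_x') - k (y_z - y_z') where x - x' = k (z - z') and all four initial values are close to \<eta>. Then
E(t) = 0 and E solves the equation linearised along y_\<eta> up to an error o(|x - x'|), uniformly on compact time
intervals, so Gronwall makes E itself o(|x - x'|), which amounts to strict differentiability at \<eta>.
*)
theory Submission
  imports Defs
begin

section \<open>Difference quotients of differentiable maps\<close>

lemma has_vector_derivative_within_iff_quotient:
  fixes f :: "real \<Rightarrow> 'a::real_normed_vector"
  shows "(f has_vector_derivative D) (at x within S) \<longleftrightarrow>
    ((\<lambda>u. (f u - f x) /\<^sub>R (u - x)) \<longlongrightarrow> D) (at x within S)"
proof -
  have "norm (f u - f x - (u - x) *\<^sub>R D) / norm (u - x) = norm ((f u - f x) /\<^sub>R (u - x) - D)"
    if "u \<noteq> x" for u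
  proof -
    have "(f u - f x) /\<^sub>R (u - x) - D = (f u - f x - (u - x) *\<^sub>R D) /\<^sub>R (u - x)"
      using that by (simp add: scaleR_diff_right)
    then show ?thesis by (simp add: divide_inverse mult.commute)
  qed
  then have "((\<lambda>u. norm (f u - f x - (u - x) *\<^sub>R D) / norm (u - x)) \<longlongrightarrow> 0) (at x within S) \<longleftrightarrow>
      ((\<lambda>u. norm ((f u - f x) /\<^sub>R (u - x) - D)) \<longlongrightarrow> 0) (at x within S)"
    by (intro Lim_cong_within) auto
  then show ?thesis
    unfolding has_vector_derivative_def has_derivative_iff_norm
    by (simp add: bounded_linear_scaleR_left tendsto_norm_zero_iff LIM_zero_iff)
qed

lemma has_derivative_imp_directional_limit:
  fixes g :: "'a::real_normed_vector \<Rightarrow> 'b::real_normed_vector"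
  assumes "(g has_derivative g') (at x)"
  shows "((\<lambda>h. (g (x + h *\<^sub>R v) - g x) /\<^sub>R h) \<longlongrightarrow> g' v) (at 0 within S)"
proof -
  have "((\<lambda>h. x + h *\<^sub>R v) has_vector_derivative v) (at 0 within S)"
    by (auto intro!: derivative_eq_intros)
  then have "((\<lambda>h. g (x + h *\<^sub>R v)) has_vector_derivative g' v) (at 0 within S)"
    using vector_derivative_diff_chain_within[of "\<lambda>h. x + h *\<^sub>R v" v 0 S g g'] assms
    by (simp add: o_def has_derivative_at_withinI)
  then show ?thesis
    by (simp add: has_vector_derivative_within_iff_quotient)
qed

lemma has_derivative_le_homogeneous:
  fixes p :: "'b::real_normed_vector \<Rightarrow> real" and q :: "'a::real_normed_vector \<Rightarrow> real"
  assumes der: "(g has_derivative g') (at x)" and p: "continuous_on UNIV p"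
    and p_scale: "\<And>r u. 0 \<le> r \<Longrightarrow> p (r *\<^sub>R u) = r * p u"
    and q_scale: "\<And>r u. 0 \<le> r \<Longrightarrow> q (r *\<^sub>R u) = r * q u"
    and le: "\<forall>\<^sub>F z in nhds x. p (g z - g x) \<le> q (z - x)"
  shows "p (g' v) \<le> q v"
proof (rule tendsto_upperbound)
  show "((\<lambda>h. p ((g (x + h *\<^sub>R v) - g x) /\<^sub>R h)) \<longlongrightarrow> p (g' v)) (at_right 0)"
    by (rule continuous_on_tendsto_compose[OF p has_derivative_imp_directional_limit[OF der]]) auto
  have "((\<lambda>h. x + h *\<^sub>R v) \<longlongrightarrow> x) (at_right 0)"
    by (auto intro!: tendsto_eq_intros)
  then have "\<forall>\<^sub>F h in at_right 0. p (g (x + h *\<^sub>R v) - g x) \<le> q (x + h *\<^sub>R v - x)"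
    by (rule eventually_compose_filterlim[OF le])
  then show "\<forall>\<^sub>F h in at_right 0. p ((g (x + h *\<^sub>R v) - g x) /\<^sub>R h) \<le> q v"
    using eventually_at_right_less[of 0]
  proof eventually_elim
    case (elim h)
    then show ?case by (simp add: p_scale q_scale inverse_eq_divide pos_divide_le_eq mult.commute)
  qed
qed simp

lemma has_derivative_lipschitz_bound:
  assumes "(g has_derivative g') (at x)" and "\<And>y z. norm (g y - g z) \<le> L * norm (y - z)"
  shows "norm (g' v) \<le> L * norm v"
  by (rule has_derivative_le_homogeneous[OF assms(1) continuous_on_norm_id]) (simp_all add: assms(2))

section \<open>Arbitrary norms on Euclidean space\<close>

lemma has_integral_closed_convex_cone:
  fixes g :: "'a::euclidean_space \<Rightarrow> 'b::euclidean_space"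
  assumes C: "closed C" "convex C" "cone C" "0 \<in> C"
    and g: "(g has_integral I) S" "\<And>s. s \<in> S \<Longrightarrow> g s \<in> C"
  shows "I \<in> C"
proof (rule ccontr)
  assume "I \<notin> C"
  then obtain u r where I_below: "u \<bullet> I < r" and C_above: "\<And>x. x \<in> C \<Longrightarrow> r < u \<bullet> x"
    using separating_hyperplane_closed_point[OF C(2,1)] by blast
  have "r < 0" using C_above[OF C(4)] by simp
  have "0 \<le> u \<bullet> x" if "x \<in> C" for x
  proof (rule ccontr)
    assume neg: "\<not> 0 \<le> u \<bullet> x"
    then have "(r / (u \<bullet> x)) *\<^sub>R x \<in> C"
      using \<open>r < 0\<close> \<open>x \<in> C\<close> by (intro mem_cone[OF C(3)]) (auto simp: divide_nonpos_nonpos)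
    then show False using C_above neg by fastforce
  qed
  then have "0 \<le> u \<bullet> I"
    using has_integral_nonneg[OF has_integral_linear[OF g(1) bounded_linear_inner_right[of u]]] g(2)
    by (simp add: o_def)
  then show False using I_below \<open>r < 0\<close> by simp
qed

locale vector_norm =
  fixes N :: "real^'n \<Rightarrow> real"
  assumes is_norm: "is_norm N"
begin

lemma N_eq_0 [simp]: "N x = 0 \<longleftrightarrow> x = 0"
  and N_add: "N (x + y) \<le> N x + N y"
  and N_scale [simp]: "N (r *\<^sub>R x) = \<bar>r\<bar> * N x"
  using is_norm unfolding is_norm_def by blast+

lemma N_minus [simp]: "N (- x) = N x"
  using N_scale[of "-1" x] by simp

lemma N_zero [simp]: "N 0 = 0"
  by simp

lemma N_nonneg [simp]: "0 \<le> N x"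
  using N_add[of x "- x"] by simp

lemma N_le_0_iff: "N x \<le> 0 \<longleftrightarrow> x = 0"
  using N_nonneg[of x] by (auto simp: order_antisym_conv)

lemma N_pos: "x \<noteq> 0 \<Longrightarrow> 0 < N x"
  using N_nonneg[of x] N_eq_0[of x] by linarith

lemma N_diff: "N (x - y) \<le> N x + N y"
  using N_add[of x "- y"] by simp

lemma N_commute: "N (x - y) = N (y - x)"
  using N_minus[of "x - y"] by simp

lemma N_sum: "finite I \<Longrightarrow> N (\<Sum>i\<in>I. g i) \<le> (\<Sum>i\<in>I. N (g i))"
proof (induction I rule: finite_induct)
  case (insert i I)
  then show ?case using N_add[of "g i" "\<Sum>i\<in>I. g i"] by simp
qed simp

lemma N_le_norm: obtains C where "0 < C" "\<And>x. N x \<le> C * norm x"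
proof
  let ?C = "1 + (\<Sum>i\<in>Basis. N i)"
  show "0 < ?C" by (simp add: add_pos_nonneg sum_nonneg)
  fix x :: "real^'n"
  have "N x = N (\<Sum>i\<in>Basis. (x \<bullet> i) *\<^sub>R i)" by (simp add: euclidean_representation)
  also have "\<dots> \<le> (\<Sum>i\<in>Basis. N ((x \<bullet> i) *\<^sub>R i))" by (rule N_sum) simp
  also have "\<dots> \<le> (\<Sum>i\<in>Basis. norm x * N i)"
    by (rule sum_mono) (simp add: Basis_le_norm mult_right_mono)
  also have "\<dots> \<le> ?C * norm x" by (simp add: sum_distrib_left algebra_simps)
  finally show "N x \<le> ?C * norm x" .
qed

lemma continuous_on_N: "continuous_on UNIV N"
proof -
  obtain C where C: "0 < C" "\<And>x. N x \<le> C * norm x" using N_le_norm by blast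
  have "\<bar>N x - N y\<bar> \<le> N (x - y)" for x y
    using N_add[of "x - y" y] N_add[of "y - x" x] N_commute[of x y] by simp
  then have "C-lipschitz_on UNIV N"
    using C order_trans[OF _ C(2)] by (auto intro!: lipschitz_onI simp: dist_norm)
  then show ?thesis by (rule lipschitz_on_continuous_on)
qed

lemma continuous_on_N_compose [continuous_intros]:
  "continuous_on S g \<Longrightarrow> continuous_on S (\<lambda>x. N (g x))"
  by (rule continuous_on_compose2[OF continuous_on_N]) auto

lemma norm_le_N: obtains C where "0 < C" "\<And>x. norm x \<le> C * N x"
proof -
  have "compact (sphere (0::real^'n) 1)" "sphere (0::real^'n) 1 \<noteq> {}" by auto
  then obtain u where u: "u \<in> sphere 0 1" "\<And>x. x \<in> sphere 0 1 \<Longrightarrow> N u \<le> N x"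
    using continuous_attains_inf[OF _ _ continuous_on_subset[OF continuous_on_N]]
    by (metis top_greatest)
  have "0 < N u" using u(1) by (intro N_pos) auto
  moreover have "norm x \<le> (1 / N u) * N x" for x
  proof (cases "x = 0")
    case False
    then have "N u \<le> N ((1 / norm x) *\<^sub>R x)" by (intro u(2)) simp
    then show ?thesis using \<open>0 < N u\<close> False by (simp add: field_simps)
  qed simp
  ultimately show ?thesis using that[of "1 / N u"] by simp
qed

lemma equivalent_to_norm:
  obtains C where "0 < C" "\<And>x. N x \<le> C * norm x" "\<And>x. norm x \<le> C * N x"
proof -
  obtain C1 where C1: "0 < C1" "\<And>x. N x \<le> C1 * norm x" using N_le_norm by blast
  obtain C2 where C2: "0 < C2" "\<And>x. norm x \<le> C2 * N x" using norm_le_N by blast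
  show ?thesis
  proof (rule that[of "max C1 C2"])
    show "N x \<le> max C1 C2 * norm x" for x
      by (rule order_trans[OF C1(2)]) (simp add: mult_right_mono)
    show "norm x \<le> max C1 C2 * N x" for x
      by (rule order_trans[OF C2(2)]) (simp add: mult_right_mono)
  qed (use C1 in simp)
qed

lemma N_matrix_vector_mult_le: "N (B *v x) \<le> mnorm N B * N x"
proof (cases "x = 0")
  case False
  obtain C where C: "0 < C" "\<And>x. N x \<le> C * norm x" "\<And>x. norm x \<le> C * N x"
    using equivalent_to_norm by blast
  have "N (B *v z) \<le> C * (onorm ((*v) B) * C)" if "N z = 1" for z
  proof -
    have "norm (B *v z) \<le> onorm ((*v) B) * norm z" by (intro onorm matrix_vector_mul_bounded_linear)
    also have "\<dots> \<le> onorm ((*v) B) * C"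
      using C(3)[of z] that by (intro mult_left_mono onorm_pos_le matrix_vector_mul_bounded_linear) simp
    finally show ?thesis using C(1,2) by (meson mult_le_cancel_left_pos order_trans)
  qed
  then have "bdd_above {N (B *v x) |x. N x = 1}" by (auto intro!: bdd_aboveI)
  then have "N (B *v ((1 / N x) *\<^sub>R x)) \<le> mnorm N B"
    unfolding mnorm_def using False by (intro cSup_upper) auto
  then show ?thesis
    using N_pos[OF False] by (simp add: matrix_vector_mult_scaleR field_simps)
qed simp

lemma N_has_integral_le:
  fixes g :: "'a::euclidean_space \<Rightarrow> real^'n"
  assumes g: "(g has_integral I) S" and h: "(h has_integral J) S" and le: "\<And>s. s \<in> S \<Longrightarrow> N (g s) \<le> h s"
  shows "N I \<le> J"
proof -
  have convex_N: "convex_on UNIV N"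
  proof (rule convex_onI)
    fix r :: real and x y assume "0 < r" "r < 1"
    then show "N ((1 - r) *\<^sub>R x + r *\<^sub>R y) \<le> (1 - r) * N x + r * N y"
      using N_add[of "(1 - r) *\<^sub>R x" "r *\<^sub>R y"] by simp
  qed simp
  have "(I, J) \<in> epigraph UNIV N"
  proof (rule has_integral_closed_convex_cone)
    show "((\<lambda>s. (g s, h s)) has_integral (I, J)) S"
      using has_integral_add[OF has_integral_linear[OF g, of "\<lambda>x. (x, 0)"]
          has_integral_linear[OF h, of "\<lambda>x. (0, x)"]]
      by (simp add: o_def bounded_linear_Pair)
    have "epigraph UNIV N = {p. N (fst p) \<le> snd p}" by (simp add: epigraph_def)
    then show "closed (epigraph UNIV N)"
      by (simp add: closed_Collect_le continuous_on_N_compose continuous_on_fst continuous_on_snd)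
    show "convex (epigraph UNIV N)" using convex_N by (rule convex_epigraphI)
    show "cone (epigraph UNIV N)" by (auto simp: cone_def epigraph_def mult_left_mono)
  qed (use le in \<open>auto simp: epigraph_def\<close>)
  then show ?thesis by (simp add: epigraph_def)
qed

lemma N_derivative_le:
  assumes der: "(g has_derivative g') (at x)" and lip: "\<And>z. N (g z - g x) \<le> k * N (z - x)"
  shows "N (g' v) \<le> k * N v"
  by (rule has_derivative_le_homogeneous[OF der continuous_on_N]) (simp_all add: lip)

lemma contraction_fixpoint:
  assumes q: "q < 1" and lip: "\<And>x y. N (T x - T y) \<le> q * N (x - y)"
  obtains x where "T x = x"
proof -
  interpret N: Metric_space UNIV "\<lambda>x y. N (x - y)"
  proof
    show "N (x - z) \<le> N (x - y) + N (y - z)" for x y z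
      using N_add[of "x - y" "y - z"] by simp
  qed (simp_all add: N_commute)
  obtain C where C: "0 < C" "\<And>x. N x \<le> C * norm x" "\<And>x. norm x \<le> C * N x"
    using equivalent_to_norm by blast
  have N_small: "N u < e" if "norm u < e / C" for u e
    using that C(1) le_less_trans[OF C(2)] by (simp add: field_simps)
  have norm_small: "norm u < e" if "N u < e / C" for u e
    using that C(1) le_less_trans[OF C(3)] by (simp add: field_simps)
  have "N.mcomplete"
    unfolding N.mcomplete_def
  proof (intro allI impI)
    fix \<sigma> assume \<sigma>: "N.MCauchy \<sigma>"
    have "Cauchy \<sigma>"
    proof (rule metric_CauchyI)
      fix e :: real assume "0 < e"
      then have "0 < e / C" using C(1) by simp
      then show "\<exists>M. \<forall>m\<ge>M. \<forall>n\<ge>M. dist (\<sigma> m) (\<sigma> n) < e"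
        using \<sigma> norm_small unfolding N.MCauchy_def dist_norm by metis
    qed
    then obtain l where l: "\<sigma> \<longlonglongrightarrow> l" by (auto simp: Cauchy_convergent_iff convergent_def)
    then have "\<forall>\<^sub>F n in sequentially. N (\<sigma> n - l) < e" if "0 < e" for e
      using tendstoD[OF l, of "e / C"] that C(1) by (auto elim!: eventually_mono intro: N_small simp: dist_norm)
    then show "\<exists>l. limitin N.mtopology \<sigma> l sequentially" by (auto simp: N.limitin_metric)
  qed
  from N.Banach_fixedpoint_thm[OF this _ _ q, of T] show ?thesis
    using lip that by auto
qed

end

section \<open>Matrix-valued functions\<close>

lemma bounded_bilinear_matrix_vector_mult:
  "bounded_bilinear ((*v) :: real^'n^'m \<Rightarrow> real^'n \<Rightarrow> real^'m)"
  unfolding bilinear_conv_bounded_bilinear[symmetric] bilinear_def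
  by (auto intro!: linearI simp: matrix_vector_mult_add_rdistrib matrix_vector_right_distrib
      scaleR_matrix_vector_assoc matrix_vector_mult_scaleR)

lemma bounded_bilinear_matrix_matrix_mult:
  "bounded_bilinear ((**) :: real^'n^'m \<Rightarrow> real^'k^'n \<Rightarrow> real^'k^'m)"
  unfolding bilinear_conv_bounded_bilinear[symmetric] bilinear_def
  by (auto intro!: linearI simp: matrix_matrix_mult_def vec_eq_iff
      sum.distrib sum_distrib_left distrib_left distrib_right mult_ac)

lemmas continuous_on_matrix_vector_mult =
  bounded_bilinear.continuous_on[OF bounded_bilinear_matrix_vector_mult]

lemma continuous_on_matrix:
  fixes B :: "'a::topological_space \<Rightarrow> real^'n^'m"
  assumes "\<And>v. continuous_on S (\<lambda>x. B x *v v)"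
  shows "continuous_on S B"
proof -
  have "continuous_on S (\<lambda>x. \<chi> i j. (B x *v axis j 1) $ i)"
    by (intro continuous_on_vec_lambda continuous_on_component assms)
  then show ?thesis by (simp add: matrix_vector_mult_basis column_def)
qed

lemma tendsto_det:
  fixes B :: "'a \<Rightarrow> real^'n^'n"
  assumes "(B \<longlongrightarrow> C) F"
  shows "((\<lambda>x. det (B x)) \<longlongrightarrow> det C) F"
  unfolding det_def by (intro tendsto_intros assms)

lemma matrix_inv_cancel:
  fixes B :: "real^'n^'n"
  assumes "invertible B"
  shows "B ** matrix_inv B = mat 1" "matrix_inv B ** B = mat 1"
  using someI_ex[OF assms[unfolded invertible_def]] unfolding matrix_inv_def by simp_all

lemma matrix_inv_cramer:
  fixes B :: "real^'n^'n"
  assumes "invertible B"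
  shows "matrix_inv B = (\<chi> i j. det (\<chi> p q. if q = i then axis j 1 $ p else B $ p $ q) / det B)"
proof -
  have "matrix_inv B *v axis j 1 = (\<chi> i. det (\<chi> p q. if q = i then axis j 1 $ p else B $ p $ q) / det B)" for j
    using assms cramer[of B "matrix_inv B *v axis j 1" "axis j 1"]
    by (simp add: matrix_vector_mul_assoc matrix_inv_cancel invertible_det_nz)
  then show ?thesis by (simp add: vec_eq_iff matrix_vector_mult_basis column_def)
qed

lemma eventually_invertible:
  fixes B :: "'a \<Rightarrow> real^'n^'n"
  assumes "(B \<longlongrightarrow> C) F" "invertible C"
  shows "\<forall>\<^sub>F x in F. invertible (B x)"
  using tendsto_imp_eventually_ne[OF tendsto_det[OF assms(1)], of 0] assms(2)
  by (simp add: invertible_det_nz)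

lemma tendsto_matrix_inv:
  fixes B :: "'a \<Rightarrow> real^'n^'n"
  assumes B: "(B \<longlongrightarrow> C) F" and "invertible C"
  shows "((\<lambda>x. matrix_inv (B x)) \<longlongrightarrow> matrix_inv C) F"
proof -
  have "det C \<noteq> 0" using \<open>invertible C\<close> by (simp add: invertible_det_nz)
  moreover have "((\<lambda>x. if q = i then axis j 1 $ p else B x $ p $ q) \<longlongrightarrow>
      (if q = i then axis j 1 $ p else C $ p $ q)) F"
    for i j p q :: 'n by (simp add: tendsto_vec_nth B)
  ultimately have "((\<lambda>x. \<chi> i j. det (\<chi> p q. if q = i then axis j 1 $ p else B x $ p $ q) / det (B x)) \<longlongrightarrow>
      (\<chi> i j. det (\<chi> p q. if q = i then axis j 1 $ p else C $ p $ q) / det C)) F"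
    by (intro tendsto_vec_lambda tendsto_divide tendsto_det B)
  then have "((\<lambda>x. \<chi> i j. det (\<chi> p q. if q = i then axis j 1 $ p else B x $ p $ q) / det (B x))
      \<longlongrightarrow> matrix_inv C) F"
    by (simp add: matrix_inv_cramer[OF \<open>invertible C\<close>])
  then show ?thesis
    by (rule Lim_transform_eventually)
       (use eventually_invertible[OF assms] in eventually_elim, simp add: matrix_inv_cramer)
qed

lemma continuous_on_matrix_inv:
  fixes B :: "'a::topological_space \<Rightarrow> real^'n^'n"
  assumes "continuous_on S B" "\<And>x. x \<in> S \<Longrightarrow> invertible (B x)"
  shows "continuous_on S (\<lambda>x. matrix_inv (B x))"
  using assms by (auto simp: continuous_on_def intro: tendsto_matrix_inv)

lemma has_vector_derivative_matrix_inv: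
  fixes X :: "real \<Rightarrow> real^'n^'n"
  assumes X: "(X has_vector_derivative X') (at s within S)" and inv: "invertible (X s)"
  shows "((\<lambda>u. matrix_inv (X u)) has_vector_derivative
    - (matrix_inv (X s) ** X' ** matrix_inv (X s))) (at s within S)"
  unfolding has_vector_derivative_within_iff_quotient
proof (rule Lim_transform_eventually)
  interpret mm: bounded_bilinear "(**) :: real^'n^'n \<Rightarrow> real^'n^'n \<Rightarrow> real^'n^'n"
    by (rule bounded_bilinear_matrix_matrix_mult)
  have lim: "(X \<longlongrightarrow> X s) (at s within S)"
    using has_vector_derivative_continuous[OF X] by (simp add: continuous_within)
  show "((\<lambda>u. - (matrix_inv (X u) ** ((X u - X s) /\<^sub>R (u - s)) ** matrix_inv (X s))) \<longlongrightarrow>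
      - (matrix_inv (X s) ** X' ** matrix_inv (X s))) (at s within S)"
    using X[unfolded has_vector_derivative_within_iff_quotient]
    by (intro tendsto_minus mm.tendsto tendsto_const tendsto_matrix_inv lim inv)
  show "\<forall>\<^sub>F u in at s within S. - (matrix_inv (X u) ** ((X u - X s) /\<^sub>R (u - s)) ** matrix_inv (X s)) =
      (matrix_inv (X u) - matrix_inv (X s)) /\<^sub>R (u - s)"
    using eventually_invertible[OF lim inv]
  proof eventually_elim
    case (elim u)
    have "matrix_inv (X u) ** (X u - X s) ** matrix_inv (X s) = matrix_inv (X s) - matrix_inv (X u)"
      by (simp add: mm.diff_left mm.diff_right matrix_inv_cancel elim inv flip: matrix_mul_assoc)
    then show ?case by (simp add: mm.scaleR_left mm.scaleR_right flip: scaleR_minus_right)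
  qed
qed

section \<open>Continuously differentiable maps\<close>

lemma C1_mapI:
  assumes der: "\<And>x. (g has_derivative g' x) (at x)" and cont: "\<And>v. continuous_on UNIV (\<lambda>x. g' x v)"
  shows "C1_map g"
  unfolding C1_map_def
proof (intro exI[of _ "\<lambda>x. matrix (g' x)"] conjI allI continuous_on_matrix)
  have works: "matrix (g' x) *v v = g' x v" for x v
    using has_derivative_linear[OF der] by (simp add: matrix_works)
  show "(g has_derivative (\<lambda>h. matrix (g' x) *v h)) (at x)" for x using der by (simp add: works)
  show "continuous_on UNIV (\<lambda>x. matrix (g' x) *v v)" for v using cont by (simp add: works)
qed

lemma C1_map_matrix_vector_mult: "C1_map ((*v) B)"
  by (rule C1_mapI[OF bounded_linear_imp_has_derivative[OF matrix_vector_mul_bounded_linear]])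
     (rule continuous_on_const)

lemma C1_map_compose:
  assumes "C1_map g" "C1_map h"
  shows "C1_map (\<lambda>x. g (h x))"
proof -
  obtain g' where g: "\<And>x. (g has_derivative (*v) (g' x)) (at x)" "continuous_on UNIV g'"
    using assms(1) unfolding C1_map_def by blast
  obtain h' where h: "\<And>x. (h has_derivative (*v) (h' x)) (at x)" "continuous_on UNIV h'"
    using assms(2) unfolding C1_map_def by blast
  have "continuous_on UNIV h" by (rule has_derivative_continuous_on[OF h(1)])
  then have "continuous_on UNIV (\<lambda>x. g' (h x) *v (h' x *v v))" for v
    by (intro continuous_on_matrix_vector_mult continuous_on_compose2[OF g(2)] h(2) continuous_on_const) auto
  then show ?thesis by (rule C1_mapI[OF has_derivative_compose[OF h(1) g(1)]])
qed

lemma integrable_derivative_dominated: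
  fixes h :: "'a::euclidean_space \<Rightarrow> 'b::euclidean_space \<Rightarrow> 'c::euclidean_space"
  assumes h: "\<And>x. (\<lambda>s. h s x) integrable_on S"
    and der: "\<And>s. s \<in> S \<Longrightarrow> (h s has_derivative h' s) (at x)"
    and L: "L integrable_on S"
    and lip: "\<And>s y z. s \<in> S \<Longrightarrow> norm (h s y - h s z) \<le> L s * norm (y - z)"
  shows "(\<lambda>s. h' s v) integrable_on S"
proof (rule dominated_convergence(1))
  let ?r = "\<lambda>n. inverse (real (Suc n))"
  have r: "filterlim ?r (at 0) sequentially"
    by (simp add: filterlim_at LIMSEQ_inverse_real_of_nat del: of_nat_Suc)
  show "(\<lambda>s. (h s (x + ?r n *\<^sub>R v) - h s x) /\<^sub>R ?r n) integrable_on S" for n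
    by (intro integrable_cmul integrable_diff h)
  show "(\<lambda>n. (h s (x + ?r n *\<^sub>R v) - h s x) /\<^sub>R ?r n) \<longlonglongrightarrow> h' s v" if "s \<in> S" for s
    using filterlim_compose[OF has_derivative_imp_directional_limit[OF der[OF that]] r] .
  show "norm ((h s (x + ?r n *\<^sub>R v) - h s x) /\<^sub>R ?r n) \<le> L s * norm v" if "s \<in> S" for n s
    using lip[OF that, of "x + ?r n *\<^sub>R v" x]
    by (simp add: inverse_eq_divide pos_le_divide_eq mult_ac del: of_nat_Suc)
  show "(\<lambda>s. L s * norm v) integrable_on S" by (rule integrable_on_mult_left[OF L])
qed

lemma bounded_linear_integral:
  fixes h :: "'a::euclidean_space \<Rightarrow> 'b::euclidean_space \<Rightarrow> 'c::real_normed_vector"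
  assumes lin: "\<And>s. s \<in> S \<Longrightarrow> linear (h s)" and int: "\<And>v. (\<lambda>s. h s v) integrable_on S"
  shows "bounded_linear (\<lambda>v. integral S (\<lambda>s. h s v))"
  unfolding linear_conv_bounded_linear[symmetric]
proof (rule linearI)
  fix u v and k :: real
  show "integral S (\<lambda>s. h s (u + v)) = integral S (\<lambda>s. h s u) + integral S (\<lambda>s. h s v)"
    by (subst Henstock_Kurzweil_Integration.integral_add[OF int int, symmetric], rule integral_cong)
       (simp add: linear_add[OF lin])
  show "integral S (\<lambda>s. h s (k *\<^sub>R v)) = k *\<^sub>R integral S (\<lambda>s. h s v)"
    by (subst integral_cmul[symmetric], rule integral_cong) (simp add: linear_cmul[OF lin])
qed

lemma has_derivative_integral_dominated:
  fixes h :: "'a::euclidean_space \<Rightarrow> 'b::euclidean_space \<Rightarrow> 'c::euclidean_space"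
  assumes h: "\<And>x. (\<lambda>s. h s x) integrable_on S"
    and der: "\<And>s. s \<in> S \<Longrightarrow> (h s has_derivative h' s) (at x)"
    and L: "L integrable_on S"
    and lip: "\<And>s y z. s \<in> S \<Longrightarrow> norm (h s y - h s z) \<le> L s * norm (y - z)"
  shows "((\<lambda>x. integral S (\<lambda>s. h s x)) has_derivative (\<lambda>v. integral S (\<lambda>s. h' s v))) (at x)"
proof -
  have h'_int: "(\<lambda>s. h' s v) integrable_on S" for v
    by (rule integrable_derivative_dominated[OF h der L lip])
  have h'_bound: "norm (h' s v) \<le> L s * norm v" if "s \<in> S" for s v
    by (rule has_derivative_lipschitz_bound[OF der lip]) (rule that)+
  let ?\<phi> = "\<lambda>x. integral S (\<lambda>s. h s x)" and ?D = "\<lambda>v. integral S (\<lambda>s. h' s v)"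
  let ?R = "\<lambda>z s. (h s z - h s x - h' s (z - x)) /\<^sub>R norm (z - x)"
  have "bounded_linear ?D"
    by (intro bounded_linear_integral has_derivative_linear[OF der] h'_int)
  moreover have "((\<lambda>z. (?\<phi> z - ?\<phi> x - ?D (z - x)) /\<^sub>R norm (z - x)) \<longlongrightarrow> 0) (at x)"
    unfolding tendsto_at_iff_sequentially o_def
  proof (intro allI impI)
    fix z assume z: "\<forall>i. z i \<in> UNIV - {x}" "z \<longlonglongrightarrow> x"
    have "(\<lambda>n. integral S (?R (z n))) \<longlonglongrightarrow> integral S (\<lambda>s. 0)"
    proof (rule dominated_convergence(2))
      show "?R (z n) integrable_on S" for n
        by (intro integrable_cmul integrable_diff h h'_int)
      show "(\<lambda>s. 2 * L s) integrable_on S" using integrable_on_mult_right[OF L] .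
      show "norm (?R (z n) s) \<le> 2 * L s" if "s \<in> S" for n s
      proof -
        have "norm (h s (z n) - h s x - h' s (z n - x)) \<le> 2 * L s * norm (z n - x)"
          using norm_triangle_le_diff[OF add_mono[OF lip[OF that, of "z n" x] h'_bound[OF that, of "z n - x"]]]
          by simp
        then show ?thesis using z(1) by (simp add: divide_inverse_commute[symmetric] pos_divide_le_eq)
      qed
      show "(\<lambda>n. ?R (z n) s) \<longlonglongrightarrow> 0" if "s \<in> S" for s
      proof -
        have "((\<lambda>z. ?R z s) \<longlongrightarrow> 0) (at x)"
          using der[OF that] by (simp add: has_derivative_within divide_inverse diff_diff_eq)
        then show ?thesis using z unfolding tendsto_at_iff_sequentially o_def by blast
      qed
    qed
    then show "(\<lambda>n. (?\<phi> (z n) - ?\<phi> x - ?D (z n - x)) /\<^sub>R norm (z n - x)) \<longlonglongrightarrow> 0"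
      by (simp add: Henstock_Kurzweil_Integration.integral_diff integrable_diff h h'_int)
  qed
  ultimately show ?thesis
    by (simp add: has_derivative_within divide_inverse diff_diff_eq)
qed

lemma C1_map_integral:
  fixes h :: "'a::euclidean_space \<Rightarrow> real^'n \<Rightarrow> real^'n"
  assumes h: "\<And>x. (\<lambda>s. h s x) integrable_on S" and C1: "\<And>s. s \<in> S \<Longrightarrow> C1_map (h s)"
    and L: "L integrable_on S"
    and lip: "\<And>s y z. s \<in> S \<Longrightarrow> norm (h s y - h s z) \<le> L s * norm (y - z)"
  shows "C1_map (\<lambda>x. integral S (\<lambda>s. h s x))"
proof -
  have "\<forall>s\<in>S. \<exists>h'. (\<forall>x. (h s has_derivative (*v) (h' x)) (at x)) \<and> continuous_on UNIV h'"
    using C1 unfolding C1_map_def by blast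
  then obtain h' where der: "\<And>s x. s \<in> S \<Longrightarrow> (h s has_derivative (*v) (h' s x)) (at x)"
    and cont: "\<And>s. s \<in> S \<Longrightarrow> continuous_on UNIV (h' s)"
    by metis
  show ?thesis
  proof (rule C1_mapI)
    show "((\<lambda>x. integral S (\<lambda>s. h s x)) has_derivative (\<lambda>v. integral S (\<lambda>s. h' s x *v v))) (at x)" for x
      by (rule has_derivative_integral_dominated[OF h der L lip])
    show "continuous_on UNIV (\<lambda>x. integral S (\<lambda>s. h' s x *v v))" for v
      unfolding continuous_on_sequentially o_def
    proof (intro ballI allI impI, elim conjE)
      fix z and x :: "real^'n" assume z: "z \<longlonglongrightarrow> x"
      show "(\<lambda>n. integral S (\<lambda>s. h' s (z n) *v v)) \<longlonglongrightarrow> integral S (\<lambda>s. h' s x *v v)"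
      proof (rule dominated_convergence(2))
        show "(\<lambda>s. h' s (z n) *v v) integrable_on S" for n
          by (rule integrable_derivative_dominated[OF h der L lip])
        show "(\<lambda>s. L s * norm v) integrable_on S" by (rule integrable_on_mult_left[OF L])
        show "norm (h' s (z n) *v v) \<le> L s * norm v" if "s \<in> S" for n s
          by (rule has_derivative_lipschitz_bound[OF der lip]) (rule that)+
        show "(\<lambda>n. h' s (z n) *v v) \<longlonglongrightarrow> h' s x *v v" if "s \<in> S" for s
          by (intro bounded_bilinear.tendsto[OF bounded_bilinear_matrix_vector_mult] tendsto_const
              continuous_on_tendsto_compose[OF cont[OF that] z]) auto
      qed
    qed
  qed
qed

lemma C1_diffeoI:
  assumes "bij g" and der: "\<And>x. (g has_derivative (*v) (B x)) (at x)"
    and B: "continuous_on UNIV B" "\<And>x. invertible (B x)"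
  shows "C1_diffeo g"
proof -
  have g_inv: "g (inv g w) = w" and inv_g: "inv g (g x) = x" for w x
    using \<open>bij g\<close> by (simp_all add: bij_def surj_f_inv_f)
  have "continuous_on UNIV g" by (rule has_derivative_continuous_on[OF der])
  then have inv_der: "(inv g has_derivative (*v) (matrix_inv (B (inv g w)))) (at w)" for w
    by (intro has_derivative_inverse_strong_x[OF open_UNIV _ _ _ der])
       (auto simp: inv_g g_inv fun_eq_iff matrix_vector_mul_assoc matrix_inv_cancel[OF B(2)])
  then have "continuous_on UNIV (inv g)" by (rule has_derivative_continuous_on)
  then have "continuous_on UNIV (\<lambda>w. matrix_inv (B (inv g w)))"
    by (intro continuous_on_matrix_inv continuous_on_compose2[OF B(1)] B(2)) auto
  then have "C1_map (inv g)"
    unfolding C1_map_def using inv_der by (intro exI[of _ "\<lambda>w. matrix_inv (B (inv g w))"]) simp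
  moreover have "C1_map g"
    unfolding C1_map_def using der B(1) by blast
  ultimately show ?thesis
    using \<open>bij g\<close> by (simp add: C1_diffeo_def)
qed

context vector_norm
begin

lemma bij_id_minus_contraction:
  assumes q: "q < 1" and lip: "\<And>x z. N (\<phi> x - \<phi> z) \<le> q * N (x - z)"
  shows "bij (\<lambda>x. x - \<phi> x)"
proof (rule bijI)
  show "inj (\<lambda>x. x - \<phi> x)"
  proof (rule injI)
    fix x z assume "x - \<phi> x = z - \<phi> z"
    then have "\<phi> x - \<phi> z = x - z" by (simp add: algebra_simps)
    then have "N (x - z) \<le> q * N (x - z)" using lip[of x z] by (simp only:)
    then have "(1 - q) * N (x - z) \<le> 0" by (simp add: algebra_simps)
    then show "x = z" using q by (simp add: mult_le_0_iff N_le_0_iff)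
  qed
  show "surj (\<lambda>x. x - \<phi> x)"
    unfolding surj_def
  proof
    fix w
    obtain x where "w + \<phi> x = x"
      using contraction_fixpoint[OF q, of "\<lambda>x. w + \<phi> x"] lip by auto
    then show "\<exists>x. w = x - \<phi> x" by (metis add_diff_cancel_right')
  qed
qed

lemma C1_diffeo_id_minus_contraction:
  assumes "C1_map \<phi>" and q: "q < 1" and lip: "\<And>x z. N (\<phi> x - \<phi> z) \<le> q * N (x - z)"
  shows "C1_diffeo (\<lambda>x. x - \<phi> x)"
proof -
  obtain B where B: "\<And>x. (\<phi> has_derivative (*v) (B x)) (at x)" "continuous_on UNIV B"
    using \<open>C1_map \<phi>\<close> unfolding C1_map_def by blast
  show ?thesis
  proof (rule C1_diffeoI[OF bij_id_minus_contraction[OF q lip]])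
    show "((\<lambda>x. x - \<phi> x) has_derivative (*v) (mat 1 - B x)) (at x)" for x
      by (auto intro!: derivative_eq_intros B simp: matrix_vector_mult_diff_rdistrib)
    show "continuous_on UNIV (\<lambda>x. mat 1 - B x)" by (intro continuous_intros B)
    show "invertible (mat 1 - B x)" for x
    proof -
      have "v = 0" if "(mat 1 - B x) *v v = 0" for v
      proof -
        have "N v \<le> q * N v"
          using N_derivative_le[OF B(1) lip, of x v] that by (simp add: matrix_vector_mult_diff_rdistrib)
        then have "(1 - q) * N v \<le> 0" by (simp add: algebra_simps)
        then show ?thesis using q by (simp add: mult_le_0_iff N_le_0_iff)
      qed
      then show ?thesis
        by (simp add: invertible_left_inverse matrix_left_invertible_ker)
    qed
  qed
qed

end

section \<open>A Cauchy criterion for strict differentiability\<close>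

definition has_strict_derivative ::
    "('a::real_normed_vector \<Rightarrow> 'b::real_normed_vector) \<Rightarrow> ('a \<Rightarrow> 'b) \<Rightarrow> 'a \<Rightarrow> bool" where
  "has_strict_derivative g g' \<eta> \<longleftrightarrow> bounded_linear g' \<and>
     (\<forall>e>0. \<exists>r>0. e-lipschitz_on (ball \<eta> r) (\<lambda>x. g x - g' x))"

lemma has_strict_derivative_imp_has_derivative:
  assumes "has_strict_derivative g g' \<eta>"
  shows "(g has_derivative g') (at \<eta>)"
  unfolding has_derivative_at_alt
proof (intro conjI allI impI)
  show lin: "bounded_linear g'" using assms by (simp add: has_strict_derivative_def)
  fix e :: real assume "0 < e"
  then obtain r where r: "0 < r" "e-lipschitz_on (ball \<eta> r) (\<lambda>x. g x - g' x)"
    using assms unfolding has_strict_derivative_def by blast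
  have "norm (g x - g \<eta> - g' (x - \<eta>)) \<le> e * norm (x - \<eta>)" if "norm (x - \<eta>) < r" for x
    using lipschitz_onD[OF r(2), of x \<eta>] that r(1)
    by (simp add: dist_norm norm_minus_commute linear_diff[OF bounded_linear.linear[OF lin]] algebra_simps)
  then show "\<exists>d>0. \<forall>x. norm (x - \<eta>) < d \<longrightarrow> norm (g x - g \<eta> - g' (x - \<eta>)) \<le> e * norm (x - \<eta>)"
    using r(1) by blast
qed

lemma obtains_mult_less:
  fixes B e :: real
  assumes "0 \<le> B" "0 < e"
  obtains d where "0 < d" "d * B < e"
proof (rule that)
  show "0 < e / (B + 1)" "e / (B + 1) * B < e"
    using assms by (simp_all add: pos_divide_less_eq distrib_left)
qed

lemma continuous_on_strict_derivative:
  assumes "\<And>x. has_strict_derivative g (g' x) x"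
  shows "continuous_on UNIV (\<lambda>x. g' x v)"
  unfolding continuous_on_iff
proof (intro ballI allI impI)
  fix \<eta> and e :: real assume "0 < e"
  then obtain e' where "0 < e'" and small: "e' * norm v < e"
    using obtains_mult_less[OF norm_ge_zero] by metis
  then obtain r where r: "0 < r" "e'-lipschitz_on (ball \<eta> r) (\<lambda>x. g x - g' \<eta> x)"
    using assms unfolding has_strict_derivative_def by blast
  have "dist (g' \<zeta> v) (g' \<eta> v) < e" if "\<zeta> \<in> ball \<eta> r" for \<zeta>
  proof -
    have "((\<lambda>x. g x - g' \<eta> x) has_derivative (\<lambda>v. g' \<zeta> v - g' \<eta> v)) (at \<zeta>)"
      using assms has_strict_derivative_imp_has_derivative has_strict_derivative_def
      by (intro has_derivative_diff bounded_linear_imp_has_derivative) blast+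
    moreover have "\<forall>\<^sub>F x in nhds \<zeta>. norm ((g x - g' \<eta> x) - (g \<zeta> - g' \<eta> \<zeta>)) \<le> e' * norm (x - \<zeta>)"
      using eventually_nhds_in_open[OF open_ball that]
      by eventually_elim (use lipschitz_onD[OF r(2) _ that] in \<open>simp add: dist_norm\<close>)
    ultimately have "norm (g' \<zeta> v - g' \<eta> v) \<le> e' * norm v"
      by (intro has_derivative_le_homogeneous[where p = norm and q = "\<lambda>u. e' * norm u"])
         (auto intro: continuous_on_norm_id)
    then show ?thesis using small by (simp add: dist_norm)
  qed
  then show "\<exists>d>0. \<forall>\<zeta>\<in>UNIV. dist \<zeta> \<eta> < d \<longrightarrow> dist (g' \<zeta> v) (g' \<eta> v) < e"
    using r(1) by (auto simp: dist_commute)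
qed

definition increment_defect :: "('a \<Rightarrow> 'b::real_vector) \<Rightarrow> real \<Rightarrow> 'a \<Rightarrow> 'a \<Rightarrow> 'a \<Rightarrow> 'a \<Rightarrow> 'b" where
  "increment_defect g k x x' z z' = (g x - g x') - k *\<^sub>R (g z - g z')"

definition proportional_pairs :: "'a::real_vector set \<Rightarrow> real \<Rightarrow> 'a \<Rightarrow> 'a \<Rightarrow> 'a \<Rightarrow> 'a \<Rightarrow> bool" where
  "proportional_pairs U k x x' z z' \<longleftrightarrow> {x, x', z, z'} \<subseteq> U \<and> x - x' = k *\<^sub>R (z - z')"

text \<open>Unlike differentiability, this can be verified for the solution map of a differential equation
  without solving the variational equation.\<close>

definition proportional_increments :: "('a::real_normed_vector \<Rightarrow> 'b::real_normed_vector) \<Rightarrow> 'a \<Rightarrow> bool" where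
  "proportional_increments g \<eta> \<longleftrightarrow> (\<forall>e>0. \<exists>r>0. \<forall>k x x' z z'. proportional_pairs (ball \<eta> r) k x x' z z' \<longrightarrow>
     norm (increment_defect g k x x' z z') \<le> e * norm (x - x'))"

definition approx_slope ::
    "('a::real_normed_vector \<Rightarrow> 'b::real_normed_vector) \<Rightarrow> 'a set \<Rightarrow> real \<Rightarrow> 'a \<Rightarrow> 'b \<Rightarrow> bool" where
  "approx_slope g U e v c \<longleftrightarrow> (\<forall>x\<in>U. \<forall>x'\<in>U. \<forall>s. x - x' = s *\<^sub>R v \<longrightarrow>
     norm (g x - g x' - s *\<^sub>R c) \<le> e * norm (x - x'))"

lemma approx_slopeD:
  assumes "approx_slope g U e v c" "x \<in> U" "x' \<in> U" "x - x' = s *\<^sub>R v"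
  shows "norm (g x - g x' - s *\<^sub>R c) \<le> e * norm (x - x')"
  using assms unfolding approx_slope_def by blast

definition has_slopes ::
    "('a::real_normed_vector \<Rightarrow> 'b::real_normed_vector) \<Rightarrow> ('a \<Rightarrow> 'b) \<Rightarrow> 'a \<Rightarrow> bool" where
  "has_slopes g l \<eta> \<longleftrightarrow> (\<forall>e>0. \<exists>r>0. \<forall>v. approx_slope g (ball \<eta> r) e v (l v))"

definition difference_quotient :: "('a::real_vector \<Rightarrow> 'b::real_vector) \<Rightarrow> 'a \<Rightarrow> 'a \<Rightarrow> nat \<Rightarrow> 'b" where
  "difference_quotient g \<eta> v n = real (Suc n) *\<^sub>R (g (\<eta> + inverse (real (Suc n)) *\<^sub>R v) - g \<eta>)"

lemma eventually_add_inverse_in_ball: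
  fixes \<eta> v :: "'a::real_normed_vector"
  assumes "0 < r"
  shows "\<forall>\<^sub>F n in sequentially. \<eta> + inverse (real (Suc n)) *\<^sub>R v \<in> ball \<eta> r"
proof -
  have "(\<lambda>n. \<eta> + inverse (real (Suc n)) *\<^sub>R v) \<longlonglongrightarrow> \<eta> + 0 *\<^sub>R v"
    by (intro tendsto_intros LIMSEQ_inverse_real_of_nat)
  then show ?thesis
    using assms by (auto dest!: topological_tendstoD[where S = "ball \<eta> r"])
qed

lemma approx_slope_difference_quotient:
  assumes "proportional_increments g \<eta>" "0 < e"
  obtains r where "0 < r" "\<And>v n. \<eta> + inverse (real (Suc n)) *\<^sub>R v \<in> ball \<eta> r \<Longrightarrow>
    approx_slope g (ball \<eta> r) e v (difference_quotient g \<eta> v n)"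
proof -
  obtain r where "0 < r" and r: "\<And>k x x' z z'. proportional_pairs (ball \<eta> r) k x x' z z' \<Longrightarrow>
      norm (increment_defect g k x x' z z') \<le> e * norm (x - x')"
    using assms unfolding proportional_increments_def by meson
  show ?thesis
  proof (rule that[OF \<open>0 < r\<close>])
    fix v n assume near: "\<eta> + inverse (real (Suc n)) *\<^sub>R v \<in> ball \<eta> r"
    show "approx_slope g (ball \<eta> r) e v (difference_quotient g \<eta> v n)"
      unfolding approx_slope_def
    proof (intro ballI allI impI)
      fix x x' s assume "x \<in> ball \<eta> r" "x' \<in> ball \<eta> r" "x - x' = s *\<^sub>R v"
      then have "proportional_pairs (ball \<eta> r) (s * real (Suc n)) x x' (\<eta> + inverse (real (Suc n)) *\<^sub>R v) \<eta>"
        using near \<open>0 < r\<close> by (simp add: proportional_pairs_def del: of_nat_Suc)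
      from r[OF this] show "norm (g x - g x' - s *\<^sub>R difference_quotient g \<eta> v n) \<le> e * norm (x - x')"
        by (simp add: increment_defect_def difference_quotient_def del: of_nat_Suc)
    qed
  qed
qed

lemma Cauchy_difference_quotient:
  assumes "proportional_increments g \<eta>"
  shows "Cauchy (difference_quotient g \<eta> v)"
proof (rule metric_CauchyI)
  let ?x = "\<lambda>n. \<eta> + inverse (real (Suc n)) *\<^sub>R v" and ?q = "difference_quotient g \<eta> v"
  fix e :: real assume "0 < e"
  then obtain e' where "0 < e'" and small: "e' * norm v < e"
    using obtains_mult_less[OF norm_ge_zero] by metis
  obtain r where "0 < r" and slope: "\<And>n. ?x n \<in> ball \<eta> r \<Longrightarrow> approx_slope g (ball \<eta> r) e' v (?q n)"
    using approx_slope_difference_quotient[OF assms \<open>0 < e'\<close>] by metis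
  obtain n0 where n0: "\<And>n. n0 \<le> n \<Longrightarrow> ?x n \<in> ball \<eta> r"
    using eventually_add_inverse_in_ball[OF \<open>0 < r\<close>] unfolding eventually_sequentially by blast
  have "dist (?q m) (?q n) < e" if "n0 \<le> m" "n0 \<le> n" for m n
  proof -
    have "inverse (real (Suc m)) *\<^sub>R (?q m - ?q n) = g (?x m) - g \<eta> - inverse (real (Suc m)) *\<^sub>R ?q n"
      by (simp add: difference_quotient_def scaleR_diff_right del: of_nat_Suc)
    moreover have "norm (g (?x m) - g \<eta> - inverse (real (Suc m)) *\<^sub>R ?q n) \<le> e' * norm (?x m - \<eta>)"
      using \<open>0 < r\<close> by (intro approx_slopeD[OF slope[OF n0[OF that(2)]] n0[OF that(1)]]) auto
    ultimately have "norm (inverse (real (Suc m)) *\<^sub>R (?q m - ?q n)) \<le> e' * norm (?x m - \<eta>)"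
      by (simp only:)
    then have "dist (?q m) (?q n) \<le> e' * norm v"
      by (simp add: dist_norm inverse_eq_divide divide_le_cancel del: of_nat_Suc)
    then show ?thesis using small by simp
  qed
  then show "\<exists>M. \<forall>m\<ge>M. \<forall>n\<ge>M. dist (?q m) (?q n) < e" by blast
qed

lemma proportional_increments_obtains_slopes:
  fixes g :: "'a::real_normed_vector \<Rightarrow> 'b::banach"
  assumes "proportional_increments g \<eta>"
  obtains l where "has_slopes g l \<eta>"
proof -
  have "\<forall>v. \<exists>l. difference_quotient g \<eta> v \<longlonglongrightarrow> l"
    using Cauchy_difference_quotient[OF assms] by (simp add: Cauchy_convergent_iff convergent_def)
  then obtain l where l: "\<And>v. difference_quotient g \<eta> v \<longlonglongrightarrow> l v" by metis
  have "\<exists>r>0. \<forall>v. approx_slope g (ball \<eta> r) e v (l v)" if "0 < e" for e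
  proof -
    obtain r where "0 < r" and slope: "\<And>v n. \<eta> + inverse (real (Suc n)) *\<^sub>R v \<in> ball \<eta> r \<Longrightarrow>
        approx_slope g (ball \<eta> r) e v (difference_quotient g \<eta> v n)"
      using approx_slope_difference_quotient[OF assms \<open>0 < e\<close>] by metis
    have "norm (g x - g x' - s *\<^sub>R l v) \<le> e * norm (x - x')"
      if "x \<in> ball \<eta> r" "x' \<in> ball \<eta> r" "x - x' = s *\<^sub>R v" for x x' s v
    proof (rule tendsto_upperbound)
      show "(\<lambda>n. norm (g x - g x' - s *\<^sub>R difference_quotient g \<eta> v n)) \<longlonglongrightarrow> norm (g x - g x' - s *\<^sub>R l v)"
        by (intro tendsto_intros l)
      show "\<forall>\<^sub>F n in sequentially. norm (g x - g x' - s *\<^sub>R difference_quotient g \<eta> v n) \<le> e * norm (x - x')"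
        using eventually_add_inverse_in_ball[OF \<open>0 < r\<close>, of \<eta> v]
        by eventually_elim (rule approx_slopeD[OF slope that])
    qed simp
    then show ?thesis using \<open>0 < r\<close> unfolding approx_slope_def by blast
  qed
  then show ?thesis using that unfolding has_slopes_def by blast
qed

lemma has_slopes_limit:
  assumes l: "has_slopes g l \<eta>" and v: "u - w = s *\<^sub>R v"
  shows "(\<lambda>n. real (Suc n) *\<^sub>R (g (\<eta> + inverse (real (Suc n)) *\<^sub>R u) - g (\<eta> + inverse (real (Suc n)) *\<^sub>R w)))
    \<longlonglongrightarrow> s *\<^sub>R l v"
proof (rule tendstoI)
  let ?x = "\<lambda>u n. \<eta> + inverse (real (Suc n)) *\<^sub>R u"
  fix e :: real assume "0 < e"
  then obtain e' where "0 < e'" and small: "e' * norm (u - w) < e"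
    using obtains_mult_less[OF norm_ge_zero] by metis
  then obtain r where "0 < r" and slope: "\<And>v. approx_slope g (ball \<eta> r) e' v (l v)"
    using l unfolding has_slopes_def by blast
  show "\<forall>\<^sub>F n in sequentially. dist (real (Suc n) *\<^sub>R (g (?x u n) - g (?x w n))) (s *\<^sub>R l v) < e"
    using eventually_add_inverse_in_ball[OF \<open>0 < r\<close>, of \<eta> u]
      eventually_add_inverse_in_ball[OF \<open>0 < r\<close>, of \<eta> w]
  proof eventually_elim
    case (elim n)
    let ?k = "real (Suc n)"
    have dx: "?x u n - ?x w n = inverse ?k *\<^sub>R (u - w)" by (simp add: scaleR_diff_right)
    have "?k *\<^sub>R (g (?x u n) - g (?x w n)) - s *\<^sub>R l v
        = ?k *\<^sub>R (g (?x u n) - g (?x w n) - (inverse ?k * s) *\<^sub>R l v)"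
      by (simp add: scaleR_diff_right del: of_nat_Suc)
    then have "dist (?k *\<^sub>R (g (?x u n) - g (?x w n))) (s *\<^sub>R l v)
        = ?k * norm (g (?x u n) - g (?x w n) - (inverse ?k * s) *\<^sub>R l v)"
      by (simp only: dist_norm norm_scaleR abs_of_nat)
    also have "\<dots> \<le> ?k * (e' * norm (?x u n - ?x w n))"
      using dx v by (intro mult_left_mono approx_slopeD[OF slope elim]) auto
    also have "\<dots> = e' * norm (u - w)" unfolding dx by (simp del: of_nat_Suc)
    finally show ?case using small by simp
  qed
qed

lemma has_slopes_imp_linear:
  assumes "has_slopes g l \<eta>"
  shows "linear l"
proof (rule linearI)
  fix v w and k :: real
  let ?x = "\<lambda>u n. \<eta> + inverse (real (Suc n)) *\<^sub>R u"
  note lim = has_slopes_limit[OF assms]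
  have "(\<lambda>n. real (Suc n) *\<^sub>R (g (?x (v + w) n) - g (?x v n)) + real (Suc n) *\<^sub>R (g (?x v n) - g (?x 0 n)))
      \<longlonglongrightarrow> 1 *\<^sub>R l w + 1 *\<^sub>R l v"
    by (intro tendsto_add lim) auto
  then have "(\<lambda>n. real (Suc n) *\<^sub>R (g (?x (v + w) n) - g (?x 0 n))) \<longlonglongrightarrow> l w + l v"
    by (simp flip: scaleR_add_right)
  then show "l (v + w) = l v + l w"
    using LIMSEQ_unique[OF lim[of "v + w" 0 1 "v + w"]] by (simp add: add.commute)
  show "l (k *\<^sub>R v) = k *\<^sub>R l v"
    using LIMSEQ_unique[OF lim[of "k *\<^sub>R v" 0 1 "k *\<^sub>R v"] lim[of "k *\<^sub>R v" 0 k v]] by simp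
qed

lemma has_slopes_imp_has_strict_derivative:
  fixes g :: "'a::euclidean_space \<Rightarrow> 'b::real_normed_vector"
  assumes "has_slopes g l \<eta>"
  shows "has_strict_derivative g l \<eta>"
  unfolding has_strict_derivative_def
proof (intro conjI allI impI)
  have lin: "linear l" using assms by (rule has_slopes_imp_linear)
  then show "bounded_linear l" by (simp add: linear_conv_bounded_linear)
  fix e :: real assume "0 < e"
  then obtain r where "0 < r" and slope: "\<And>v. approx_slope g (ball \<eta> r) e v (l v)"
    using assms unfolding has_slopes_def by blast
  have "e-lipschitz_on (ball \<eta> r) (\<lambda>x. g x - l x)"
  proof (rule lipschitz_onI)
    fix x x' assume "x \<in> ball \<eta> r" "x' \<in> ball \<eta> r"
    then have "norm (g x - g x' - 1 *\<^sub>R l (x - x')) \<le> e * norm (x - x')"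
      by (intro approx_slopeD[OF slope]) auto
    then show "dist (g x - l x) (g x' - l x') \<le> e * dist x x'"
      by (simp add: dist_norm linear_diff[OF lin] algebra_simps)
  qed (use \<open>0 < e\<close> in simp)
  then show "\<exists>r>0. e-lipschitz_on (ball \<eta> r) (\<lambda>x. g x - l x)" using \<open>0 < r\<close> by blast
qed

lemma C1_map_proportional_increments:
  assumes "\<And>\<eta>. proportional_increments g \<eta>"
  shows "C1_map g"
proof -
  have "\<forall>\<eta>. \<exists>g'. has_strict_derivative g g' \<eta>"
    using proportional_increments_obtains_slopes[OF assms] has_slopes_imp_has_strict_derivative by metis
  then obtain g' where g': "\<And>\<eta>. has_strict_derivative g (g' \<eta>) \<eta>" by metis
  show ?thesis
    by (rule C1_mapI[OF has_strict_derivative_imp_has_derivative continuous_on_strict_derivative]) (rule g')+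
qed

context vector_norm
begin

definition "N_ball \<eta> r = {x. N (x - \<eta>) < r}"

lemma N_increment_defect_le:
  assumes k: "x - x' = k *\<^sub>R (z - z')"
    and lip: "N (g x - g x') \<le> L * N (x - x')" "N (g z - g z') \<le> L * N (z - z')"
  shows "N (increment_defect g k x x' z z') \<le> 2 * L * N (x - x')"
proof -
  have "N (increment_defect g k x x' z z') \<le> N (g x - g x') + \<bar>k\<bar> * N (g z - g z')"
    using N_diff[of "g x - g x'" "k *\<^sub>R (g z - g z')"] by (simp add: increment_defect_def)
  also have "\<dots> \<le> L * N (x - x') + \<bar>k\<bar> * (L * N (z - z'))"
    by (intro add_mono lip mult_left_mono) auto
  also have "\<dots> = 2 * L * N (x - x')" by (simp add: k)
  finally show ?thesis .
qed

lemma proportional_increments_N: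
  assumes "\<And>e. 0 < e \<Longrightarrow> \<exists>r>0. \<forall>k x x' z z'. proportional_pairs (N_ball \<eta> r) k x x' z z' \<longrightarrow>
      N (increment_defect g k x x' z z') \<le> e * N (x - x')"
  shows "proportional_increments g \<eta>"
  unfolding proportional_increments_def
proof (intro allI impI)
  fix e :: real assume "0 < e"
  obtain C where C: "0 < C" "\<And>x. N x \<le> C * norm x" "\<And>x. norm x \<le> C * N x"
    using equivalent_to_norm by blast
  have "0 < e / (C * C)" using \<open>0 < e\<close> C(1) by simp
  then obtain r where "0 < r" and r: "\<And>k x x' z z'. proportional_pairs (N_ball \<eta> r) k x x' z z' \<Longrightarrow>
      N (increment_defect g k x x' z z') \<le> e / (C * C) * N (x - x')"
    using assms by meson
  have "C * norm (x - \<eta>) < r" if "x \<in> ball \<eta> (r / C)" for x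
    using that C(1) by (simp add: dist_norm norm_minus_commute pos_less_divide_eq mult.commute)
  then have "ball \<eta> (r / C) \<subseteq> N_ball \<eta> r"
    using le_less_trans[OF C(2)] by (auto simp: N_ball_def)
  then have near: "proportional_pairs (N_ball \<eta> r) k x x' z z'"
    if "proportional_pairs (ball \<eta> (r / C)) k x x' z z'" for k x x' z z'
    using that unfolding proportional_pairs_def by blast
  have "norm (increment_defect g k x x' z z') \<le> e * norm (x - x')"
    if "proportional_pairs (ball \<eta> (r / C)) k x x' z z'" for k x x' z z'
  proof -
    have "norm (increment_defect g k x x' z z') \<le> C * N (increment_defect g k x x' z z')" by (rule C)
    also have "\<dots> \<le> C * (e / (C * C) * (C * norm (x - x')))"
      using C(1) \<open>0 < e\<close> by (intro mult_left_mono order_trans[OF r[OF near[OF that]]] C(2)) auto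
    also have "\<dots> = e * norm (x - x')" using C(1) by simp
    finally show ?thesis .
  qed
  moreover have "0 < r / C" using \<open>0 < r\<close> C(1) by simp
  ultimately show "\<exists>r>0. \<forall>k x x' z z'. proportional_pairs (ball \<eta> r) k x x' z z' \<longrightarrow>
      norm (increment_defect g k x x' z z') \<le> e * norm (x - x')"
    by blast
qed

end

section \<open>Gronwall's inequality and variation of constants\<close>

lemma gronwall:
  fixes v w :: "real \<Rightarrow> real"
  assumes "p \<le> r" and v: "continuous_on {p..r} v" and w: "continuous_on {p..r} w"
    and w_nonneg: "\<And>s. s \<in> {p..r} \<Longrightarrow> 0 \<le> w s"
    and v_le: "\<And>s. s \<in> {p..r} \<Longrightarrow> v s \<le> c + integral {p..s} (\<lambda>u. w u * v u)"
  shows "v r \<le> c * exp (integral {p..r} w)"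
proof -
  define U where "U = (\<lambda>s. c + integral {p..s} (\<lambda>u. w u * v u))"
  define W where "W = (\<lambda>s. integral {p..s} w)"
  have U: "(U has_real_derivative w s * v s) (at s within {p..r})"
    and W: "(W has_real_derivative w s) (at s within {p..r})" if "s \<in> {p..r}" for s
    unfolding U_def W_def
    using integral_has_real_derivative[OF continuous_on_mult[OF w v] that]
      integral_has_real_derivative[OF w that]
    by (auto intro!: derivative_eq_intros)
  have "((\<lambda>s. (w s * v s - U s * w s) * exp (- W s)) has_integral
      U r * exp (- W r) - U p * exp (- W p)) {p..r}"
  proof (rule fundamental_theorem_of_calculus[OF \<open>p \<le> r\<close>])
    fix s assume s: "s \<in> {p..r}"
    show "((\<lambda>s. U s * exp (- W s)) has_vector_derivative (w s * v s - U s * w s) * exp (- W s))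
        (at s within {p..r})"
      unfolding has_real_derivative_iff_has_vector_derivative[symmetric]
      by (auto intro!: derivative_eq_intros U[OF s] W[OF s] simp: algebra_simps)
  qed
  moreover have "(w s * v s - U s * w s) * exp (- W s) \<le> 0" if "s \<in> {p..r}" for s
    using mult_left_mono[OF v_le[OF that] w_nonneg[OF that]]
    by (simp add: U_def mult_le_0_iff mult.commute)
  ultimately have "U r * exp (- W r) - U p * exp (- W p) \<le> 0"
    using has_integral_le[OF _ has_integral_0] by blast
  then have "U r \<le> c * exp (W r)"
    by (simp add: U_def W_def exp_minus divide_inverse[symmetric] pos_divide_le_eq)
  then show ?thesis using v_le[of r] \<open>p \<le> r\<close> by (simp add: U_def W_def)
qed

lemma gronwall_closed_segment:
  fixes v w :: "real \<Rightarrow> real"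
  assumes v: "continuous_on (closed_segment t s) v" and w: "continuous_on (closed_segment t s) w"
    and w_nonneg: "\<And>r. r \<in> closed_segment t s \<Longrightarrow> 0 \<le> w r"
    and v_le: "\<And>r. r \<in> closed_segment t s \<Longrightarrow> v r \<le> c + integral (closed_segment t r) (\<lambda>u. w u * v u)"
  shows "v s \<le> c * exp (integral (closed_segment t s) w)"
proof (cases "t \<le> s")
  case True
  then show ?thesis
    using gronwall[of t s v w c] assms by (auto simp: closed_segment_eq_real_ivl)
next
  case False
  have "v (- (- s)) \<le> c * exp (integral {- t..- s} (\<lambda>u. w (- u)))"
  proof (rule gronwall)
    show "continuous_on {- t..- s} (\<lambda>u. v (- u))" "continuous_on {- t..- s} (\<lambda>u. w (- u))"
      using False
      by (auto intro!: continuous_on_compose2[OF v] continuous_on_compose2[OF w] continuous_intros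
          simp: closed_segment_eq_real_ivl)
    fix u assume u: "u \<in> {- t..- s}"
    then show "0 \<le> w (- u)" using w_nonneg[of "- u"] False by (simp add: closed_segment_eq_real_ivl)
    show "v (- u) \<le> c + integral {- t..u} (\<lambda>u. w (- u) * v (- u))"
      using v_le[of "- u"] u False
        Henstock_Kurzweil_Integration.integral_reflect_real[of t "- u" "\<lambda>u. w u * v u"]
      by (cases "u = - t") (auto simp: closed_segment_eq_real_ivl)
  qed (use False in simp)
  then show ?thesis
    using False Henstock_Kurzweil_Integration.integral_reflect_real[of t s w]
    by (simp add: closed_segment_eq_real_ivl)
qed

lemma closed_segment_subset_atLeast:
  fixes c t s :: real
  assumes "c \<le> t" "c \<le> s"
  shows "closed_segment t s \<subseteq> {c..}"
  using assms by (intro closed_segment_subset convex_real_interval) auto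

lemma integral_exp_segment_le:
  fixes k t s :: real
  assumes "0 < k" "0 \<le> t" "0 \<le> s"
  shows "integral (closed_segment t s) (\<lambda>u. exp (- k * u)) \<le> 1 / k"
proof -
  have "((\<lambda>u. exp (- k * u)) has_integral 1 / k) {0..}"
    using has_integral_exp_minus_to_infinity[OF \<open>0 < k\<close>, of 0] by simp
  moreover have "(\<lambda>u. exp (- k * u)) integrable_on closed_segment t s"
    by (intro integrable_continuous_closed_segment continuous_intros)
  moreover have "closed_segment t s \<subseteq> {0..}"
    using assms(2,3) by (rule closed_segment_subset_atLeast)
  ultimately show ?thesis
    using integral_subset_le[of "closed_segment t s" "{0..}" "\<lambda>u. exp (- k * u)"]
    by (auto simp: has_integral_iff)
qed

lemma evol_mult_vec: "evol X t s *v h = X t *v (matrix_inv (X s) *v h)"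
  by (simp add: evol_def matrix_vector_mul_assoc)

lemma evol_self: "invertible (X t) \<Longrightarrow> evol X t t *v h = h"
  by (simp add: evol_def matrix_inv_cancel)

lemma has_vector_derivative_evol:
  assumes X: "(X has_vector_derivative B ** X u) (at u within S)" and inv: "invertible (X u)"
    and \<Delta>: "(\<Delta> has_vector_derivative B *v \<Delta> u + g) (at u within S)"
  shows "((\<lambda>u. evol X r u *v \<Delta> u) has_vector_derivative evol X r u *v g) (at u within S)"
proof -
  interpret mv: bounded_bilinear "(*v) :: real^'n^'n \<Rightarrow> real^'n \<Rightarrow> real^'n"
    by (rule bounded_bilinear_matrix_vector_mult)
  have "matrix_inv (X u) ** (B ** X u) ** matrix_inv (X u) = matrix_inv (X u) ** B"
    using inv by (simp add: matrix_inv_cancel flip: matrix_mul_assoc)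
  then have "((\<lambda>u. matrix_inv (X u) *v \<Delta> u) has_vector_derivative matrix_inv (X u) *v g) (at u within S)"
    using mv.has_vector_derivative[OF has_vector_derivative_matrix_inv[OF X inv] \<Delta>]
    by (simp add: mv.add_right mv.minus_left matrix_vector_mul_assoc)
  from bounded_linear.has_vector_derivative[OF matrix_vector_mul_bounded_linear this]
  show ?thesis unfolding evol_mult_vec .
qed

locale nonuniform_bounded_growth = vector_norm N
  for N :: "real^'n \<Rightarrow> real" +
  fixes A :: "real \<Rightarrow> real^'n^'n" and X :: "real \<Rightarrow> real^'n^'n" and K0 a \<epsilon> :: real
  assumes X_inv: "0 \<le> t \<Longrightarrow> invertible (X t)"
    and X_deriv: "0 \<le> t \<Longrightarrow> (X has_vector_derivative (A t ** X t)) (at t within {0..})"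
    and growth: "0 \<le> t \<Longrightarrow> 0 \<le> s \<Longrightarrow> mnorm N (evol X t s) \<le> K0 * exp (a * \<bar>t - s\<bar> + \<epsilon> * s)"
    and K0: "1 \<le> K0" and a: "0 < a"
begin

lemma evol_bound:
  assumes "0 \<le> t" "0 \<le> s"
  shows "N (evol X t s *v h) \<le> K0 * exp (a * \<bar>t - s\<bar> + \<epsilon> * s) * N h"
  using N_matrix_vector_mult_le growth[OF assms] by (rule order_trans[OF _ mult_right_mono]) simp

lemma continuous_on_evol: "continuous_on {0..} (evol X t)"
  unfolding evol_def
  by (intro bounded_bilinear.continuous_on[OF bounded_bilinear_matrix_matrix_mult] continuous_on_const
      continuous_on_matrix_inv continuous_on_vector_derivative[OF X_deriv] X_inv) auto

definition inhomogeneous_solution :: "(real \<Rightarrow> real^'n) \<Rightarrow> (real \<Rightarrow> real^'n) \<Rightarrow> bool" where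
  "inhomogeneous_solution g \<Delta> \<longleftrightarrow>
     (\<forall>u\<ge>0. (\<Delta> has_vector_derivative A u *v \<Delta> u + g u) (at u within {0..}))"

lemma continuous_on_inhomogeneous_solution:
  assumes "inhomogeneous_solution g \<Delta>" "S \<subseteq> {0..}"
  shows "continuous_on S \<Delta>"
proof -
  have "continuous_on {0..} \<Delta>"
    using assms(1) by (intro continuous_on_vector_derivative[where f' = "\<lambda>u. A u *v \<Delta> u + g u"])
      (simp add: inhomogeneous_solution_def)
  then show ?thesis using assms(2) by (rule continuous_on_subset)
qed

lemma inhomogeneous_solution_diff_scaleR:
  assumes "inhomogeneous_solution g \<Delta>" "inhomogeneous_solution h \<Gamma>"
  shows "inhomogeneous_solution (\<lambda>u. g u - k *\<^sub>R h u) (\<lambda>u. \<Delta> u - k *\<^sub>R \<Gamma> u)"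
  unfolding inhomogeneous_solution_def
proof (intro allI impI)
  fix u :: real assume "0 \<le> u"
  then have "((\<lambda>u. \<Delta> u - k *\<^sub>R \<Gamma> u) has_vector_derivative
      A u *v \<Delta> u + g u - k *\<^sub>R (A u *v \<Gamma> u + h u)) (at u within {0..})"
    using assms unfolding inhomogeneous_solution_def
    by (intro has_vector_derivative_diff bounded_linear.has_vector_derivative[OF bounded_linear_scaleR_right]) auto
  then show "((\<lambda>u. \<Delta> u - k *\<^sub>R \<Gamma> u) has_vector_derivative
      A u *v (\<Delta> u - k *\<^sub>R \<Gamma> u) + (g u - k *\<^sub>R h u)) (at u within {0..})"
    by (simp add: matrix_vector_mult_scaleR algebra_simps)
qed

lemma variation_of_constants_le:
  assumes \<Delta>: "inhomogeneous_solution g \<Delta>" and "0 \<le> t" "0 \<le> r"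
    and h: "(h has_integral J) (closed_segment t r)"
    and le: "\<And>u. u \<in> closed_segment t r \<Longrightarrow> N (evol X r u *v g u) \<le> h u"
  shows "N (\<Delta> r - evol X r t *v \<Delta> t) \<le> J"
proof -
  have duhamel: "((\<lambda>u. evol X r u *v g u) has_integral evol X r q *v \<Delta> q - evol X r p *v \<Delta> p) {p..q}"
    if "0 \<le> p" "p \<le> q" for p q
  proof (rule fundamental_theorem_of_calculus[OF \<open>p \<le> q\<close>])
    fix u assume "u \<in> {p..q}"
    then have "0 \<le> u" using \<open>0 \<le> p\<close> by simp
    then have "((\<lambda>u. evol X r u *v \<Delta> u) has_vector_derivative evol X r u *v g u) (at u within {0..})"
      using \<Delta> by (intro has_vector_derivative_evol[where B = "A u"] X_deriv X_inv)
        (simp_all add: inhomogeneous_solution_def)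
    then show "((\<lambda>u. evol X r u *v \<Delta> u) has_vector_derivative evol X r u *v g u) (at u within {p..q})"
      by (rule has_vector_derivative_within_subset) (use \<open>0 \<le> p\<close> in auto)
  qed
  have self: "evol X r r *v \<Delta> r = \<Delta> r" by (intro evol_self X_inv \<open>0 \<le> r\<close>)
  show ?thesis
  proof (cases "t \<le> r")
    case True
    then show ?thesis
      using N_has_integral_le[OF duhamel[OF \<open>0 \<le> t\<close> True]] h le
      by (simp add: self closed_segment_eq_real_ivl)
  next
    case False
    then show ?thesis
      using N_has_integral_le[OF duhamel[OF \<open>0 \<le> r\<close>, of t]] h le
      by (simp add: self closed_segment_eq_real_ivl N_commute)
  qed
qed

lemma evol_forcing_bound:
  assumes h: "N h \<le> L * exp (- \<theta> * u) * (d + e)" and u: "u \<in> closed_segment t r"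
    and "0 \<le> t" "0 \<le> r" "0 \<le> L" "0 \<le> e"
  shows "N (evol X r u *v h) \<le>
    exp (a * \<bar>r - t\<bar>) * (K0 * L * exp (- (\<theta> - \<epsilon>) * u) * (exp (- a * \<bar>u - t\<bar>) * d + e))"
proof -
  let ?v = "exp (- a * \<bar>u - t\<bar>) * d + e"
  have "0 \<le> u" using closed_segment_subset_atLeast[OF \<open>0 \<le> t\<close> \<open>0 \<le> r\<close>] u by auto
  have split: "\<bar>r - t\<bar> = \<bar>r - u\<bar> + \<bar>u - t\<bar>"
    using u by (auto simp: closed_segment_eq_real_ivl split: if_splits)
  have "1 * e \<le> exp (a * \<bar>u - t\<bar>) * e" using a \<open>0 \<le> e\<close> by (intro mult_right_mono) auto
  moreover have "exp (a * \<bar>u - t\<bar>) * ?v = d + exp (a * \<bar>u - t\<bar>) * e"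
    by (simp add: distrib_left mult.assoc[symmetric] exp_add[symmetric])
  ultimately have d_le: "d + e \<le> exp (a * \<bar>u - t\<bar>) * ?v" by simp
  have "N (evol X r u *v h) \<le> K0 * exp (a * \<bar>r - u\<bar> + \<epsilon> * u) * N h"
    by (rule evol_bound[OF \<open>0 \<le> r\<close> \<open>0 \<le> u\<close>])
  also have "\<dots> \<le> K0 * exp (a * \<bar>r - u\<bar> + \<epsilon> * u) * (L * exp (- \<theta> * u) * (exp (a * \<bar>u - t\<bar>) * ?v))"
    using K0 \<open>0 \<le> L\<close> d_le by (intro mult_left_mono order_trans[OF h]) auto
  also have "\<dots> = (exp (a * \<bar>r - u\<bar> + \<epsilon> * u) * exp (- \<theta> * u) * exp (a * \<bar>u - t\<bar>)) * (K0 * L * ?v)"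
    by (simp add: mult_ac)
  also have "exp (a * \<bar>r - u\<bar> + \<epsilon> * u) * exp (- \<theta> * u) * exp (a * \<bar>u - t\<bar>)
      = exp (a * \<bar>r - t\<bar>) * exp (- (\<theta> - \<epsilon>) * u)"
    unfolding split exp_add[symmetric] by (simp add: algebra_simps)
  finally show ?thesis by (simp add: mult_ac)
qed

lemma perturbation_integral_inequality:
  assumes \<Delta>: "inhomogeneous_solution g \<Delta>" and "0 \<le> t" "0 \<le> r" "0 \<le> L" "0 \<le> e"
    and g: "\<And>u. u \<in> closed_segment t r \<Longrightarrow> N (g u) \<le> L * exp (- \<theta> * u) * (N (\<Delta> u) + e)"
  defines "v \<equiv> \<lambda>u. exp (- a * \<bar>u - t\<bar>) * N (\<Delta> u) + e" and "w \<equiv> \<lambda>u. K0 * L * exp (- (\<theta> - \<epsilon>) * u)"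
  shows "v r \<le> K0 * (exp (\<epsilon> * t) * N (\<Delta> t) + e) + integral (closed_segment t r) (\<lambda>u. w u * v u)"
proof -
  have seg: "closed_segment t r \<subseteq> {0..}"
    using \<open>0 \<le> t\<close> \<open>0 \<le> r\<close> by (rule closed_segment_subset_atLeast)
  let ?R = "exp (a * \<bar>r - t\<bar>)" and ?J = "integral (closed_segment t r) (\<lambda>u. w u * v u)"
  have "((\<lambda>u. w u * v u) has_integral ?J) (closed_segment t r)"
    unfolding w_def v_def
    by (intro integrable_integral integrable_continuous_closed_segment continuous_intros
        continuous_on_inhomogeneous_solution[OF \<Delta> seg])
  then have "((\<lambda>u. ?R * (w u * v u)) has_integral ?R * ?J) (closed_segment t r)"
    by (rule has_integral_mult_right)
  moreover have "N (evol X r u *v g u) \<le> ?R * (w u * v u)" if "u \<in> closed_segment t r" for u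
    using evol_forcing_bound[OF g[OF that] that] \<open>0 \<le> t\<close> \<open>0 \<le> r\<close> \<open>0 \<le> L\<close> \<open>0 \<le> e\<close> by (simp add: v_def w_def)
  ultimately have "N (\<Delta> r - evol X r t *v \<Delta> t) \<le> ?R * ?J"
    by (rule variation_of_constants_le[OF \<Delta> \<open>0 \<le> t\<close> \<open>0 \<le> r\<close>])
  moreover have "N (evol X r t *v \<Delta> t) \<le> ?R * (K0 * (exp (\<epsilon> * t) * N (\<Delta> t)))"
    using evol_bound[OF \<open>0 \<le> r\<close> \<open>0 \<le> t\<close>, of "\<Delta> t"] by (simp add: exp_add mult_ac)
  moreover have "N (\<Delta> r) \<le> N (evol X r t *v \<Delta> t) + N (\<Delta> r - evol X r t *v \<Delta> t)"
    using N_add[of "evol X r t *v \<Delta> t" "\<Delta> r - evol X r t *v \<Delta> t"] by simp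
  ultimately have "N (\<Delta> r) \<le> ?R * (K0 * (exp (\<epsilon> * t) * N (\<Delta> t)) + ?J)"
    by (simp add: distrib_left)
  then have "exp (- a * \<bar>r - t\<bar>) * N (\<Delta> r) \<le> K0 * (exp (\<epsilon> * t) * N (\<Delta> t)) + ?J"
    by (simp add: exp_minus inverse_eq_divide pos_divide_le_eq mult.commute)
  moreover have "1 * e \<le> K0 * e" using K0 \<open>0 \<le> e\<close> by (rule mult_right_mono)
  ultimately show ?thesis by (simp add: v_def distrib_left)
qed

lemma perturbation_bound:
  assumes \<Delta>: "inhomogeneous_solution g \<Delta>" and "0 \<le> t" "0 \<le> s" "0 \<le> L" "0 \<le> e" "\<epsilon> < \<theta>"
    and g: "\<And>u. u \<in> closed_segment t s \<Longrightarrow> N (g u) \<le> L * exp (- \<theta> * u) * (N (\<Delta> u) + e)"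
  shows "N (\<Delta> s) \<le> K0 * exp (L * K0 / (\<theta> - \<epsilon>)) * exp (a * \<bar>s - t\<bar>) * (exp (\<epsilon> * t) * N (\<Delta> t) + e)"
proof -
  define v where "v = (\<lambda>u. exp (- a * \<bar>u - t\<bar>) * N (\<Delta> u) + e)"
  define w where "w = (\<lambda>u. K0 * L * exp (- (\<theta> - \<epsilon>) * u))"
  define c where "c = K0 * (exp (\<epsilon> * t) * N (\<Delta> t) + e)"
  have "0 \<le> c" using K0 \<open>0 \<le> e\<close> by (simp add: c_def)
  have seg: "closed_segment t s \<subseteq> {0..}"
    using \<open>0 \<le> t\<close> \<open>0 \<le> s\<close> by (rule closed_segment_subset_atLeast)
  have "v s \<le> c * exp (integral (closed_segment t s) w)"
  proof (rule gronwall_closed_segment)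
    show "continuous_on (closed_segment t s) v" "continuous_on (closed_segment t s) w"
      unfolding v_def w_def
      by (intro continuous_intros continuous_on_inhomogeneous_solution[OF \<Delta> seg])+
    fix r assume r: "r \<in> closed_segment t s"
    show "0 \<le> w r" using K0 \<open>0 \<le> L\<close> by (simp add: w_def)
    have "closed_segment t r \<subseteq> closed_segment t s" using r by (simp add: subset_closed_segment)
    then show "v r \<le> c + integral (closed_segment t r) (\<lambda>u. w u * v u)"
      unfolding v_def w_def c_def using r seg
      by (intro perturbation_integral_inequality[OF \<Delta>] g \<open>0 \<le> t\<close> \<open>0 \<le> L\<close> \<open>0 \<le> e\<close>) auto
  qed
  also have "\<dots> \<le> c * exp (L * K0 / (\<theta> - \<epsilon>))"
  proof -
    have "integral (closed_segment t s) w \<le> K0 * L * (1 / (\<theta> - \<epsilon>))"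
      unfolding w_def Henstock_Kurzweil_Integration.integral_mult_right
      using K0 \<open>0 \<le> L\<close> \<open>\<epsilon> < \<theta>\<close> \<open>0 \<le> t\<close> \<open>0 \<le> s\<close> by (intro mult_left_mono integral_exp_segment_le) auto
    then show ?thesis using \<open>0 \<le> c\<close> by (intro mult_left_mono) (simp_all add: mult.commute)
  qed
  finally have "exp (- a * \<bar>s - t\<bar>) * N (\<Delta> s) \<le> c * exp (L * K0 / (\<theta> - \<epsilon>))"
    using \<open>0 \<le> e\<close> by (simp add: v_def)
  then show ?thesis
    by (simp add: exp_minus inverse_eq_divide pos_divide_le_eq c_def mult_ac)
qed

end

section \<open>Smoothness of the flow\<close>

lemma uniformly_close_near_compact_graph:
  fixes D :: "'s::metric_space \<Rightarrow> 'a::euclidean_space \<Rightarrow> 'b::metric_space"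
  assumes "compact S" and \<gamma>: "continuous_on S \<gamma>" and D: "continuous_on (S \<times> UNIV) (\<lambda>(s, x). D s x)"
    and "0 < e"
  obtains r where "0 < r" "\<And>s x. s \<in> S \<Longrightarrow> x \<in> ball (\<gamma> s) r \<Longrightarrow> dist (D s x) (D s (\<gamma> s)) < e"
proof -
  let ?Q = "S \<times> cball (0::'a) 1" and ?D = "\<lambda>(s, x). D s (\<gamma> s + x)"
  have "continuous_on ?Q (\<lambda>q. (\<lambda>(s, x). D s x) (fst q, \<gamma> (fst q) + snd q))"
    by (intro continuous_on_compose2[OF D] continuous_intros continuous_on_compose2[OF \<gamma>]) auto
  then have "continuous_on ?Q ?D" by (simp add: case_prod_unfold)
  then have "uniformly_continuous_on ?Q ?D"
    by (rule compact_uniformly_continuous) (intro compact_Times \<open>compact S\<close> compact_cball)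
  then obtain d where d: "0 < d"
    "\<And>q q'. q \<in> ?Q \<Longrightarrow> q' \<in> ?Q \<Longrightarrow> dist q' q < d \<Longrightarrow> dist (?D q') (?D q) < e"
    using \<open>0 < e\<close> unfolding uniformly_continuous_on_def by meson
  show ?thesis
  proof (rule that[of "min d 1"])
    fix s x assume "s \<in> S" "x \<in> ball (\<gamma> s) (min d 1)"
    then show "dist (D s x) (D s (\<gamma> s)) < e"
      using d(2)[of "(s, 0)" "(s, x - \<gamma> s)"] by (simp add: dist_Pair_Pair dist_norm norm_minus_commute)
  qed (use d(1) in simp)
qed

lemma uniformly_strict_derivative_compact:
  fixes F :: "'s::metric_space \<Rightarrow> real^'n \<Rightarrow> real^'m"
  assumes "compact S" and \<gamma>: "continuous_on S \<gamma>"
    and der: "\<And>s x. s \<in> S \<Longrightarrow> (F s has_derivative (*v) (DF s x)) (at x)"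
    and DF: "continuous_on (S \<times> UNIV) (\<lambda>(s, x). DF s x)" and "0 < e"
  obtains r where "0 < r" "\<And>s. s \<in> S \<Longrightarrow> e-lipschitz_on (ball (\<gamma> s) r) (\<lambda>x. F s x - DF s (\<gamma> s) *v x)"
proof -
  obtain C where C: "0 < C" "\<And>(B::real^'n^'m) h. norm (B *v h) \<le> norm B * norm h * C"
    using bounded_bilinear.pos_bounded[OF bounded_bilinear_matrix_vector_mult] by blast
  have "0 < e / C" using \<open>0 < e\<close> C(1) by simp
  then obtain r where "0 < r" and r: "\<And>s x. s \<in> S \<Longrightarrow> x \<in> ball (\<gamma> s) r \<Longrightarrow> dist (DF s x) (DF s (\<gamma> s)) < e / C"
    using uniformly_close_near_compact_graph[OF \<open>compact S\<close> \<gamma> DF, of "e / C"] by blast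
  show ?thesis
  proof (rule that[OF \<open>0 < r\<close>])
    fix s assume s: "s \<in> S"
    have onorm_le: "onorm ((*v) (DF s x - DF s (\<gamma> s))) \<le> e" if "x \<in> ball (\<gamma> s) r" for x
    proof (rule onorm_le)
      fix h :: "real^'n"
      have "norm (DF s x - DF s (\<gamma> s)) * norm h * C \<le> e / C * norm h * C"
        using r[OF s that] C(1) by (intro mult_right_mono) (auto simp: dist_norm)
      then show "norm ((DF s x - DF s (\<gamma> s)) *v h) \<le> e * norm h"
        using C by (auto intro: order_trans)
    qed
    show "e-lipschitz_on (ball (\<gamma> s) r) (\<lambda>x. F s x - DF s (\<gamma> s) *v x)"
    proof (rule lipschitz_onI)
      fix x x' assume x: "x \<in> ball (\<gamma> s) r" "x' \<in> ball (\<gamma> s) r"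
      show "dist (F s x - DF s (\<gamma> s) *v x) (F s x' - DF s (\<gamma> s) *v x') \<le> e * dist x x'"
        unfolding dist_norm
      proof (rule differentiable_bound[OF convex_ball _ onorm_le x])
        show "((\<lambda>x. F s x - DF s (\<gamma> s) *v x) has_derivative (*v) (DF s z - DF s (\<gamma> s)))
            (at z within ball (\<gamma> s) r)" for z
          unfolding matrix_vector_mult_diff_rdistrib
          by (intro has_derivative_diff has_derivative_at_withinI[OF der[OF s]]
              bounded_linear_imp_has_derivative matrix_vector_mul_bounded_linear)
      qed
    qed (use \<open>0 < e\<close> in simp)
  qed
qed

locale perturbed_linear_system = nonuniform_bounded_growth N A X K0 a \<epsilon>
  for N :: "real^'n \<Rightarrow> real" and A X K0 a \<epsilon> +
  fixes f :: "real \<Rightarrow> real^'n \<Rightarrow> real^'n"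
    and y :: "real \<Rightarrow> real \<Rightarrow> real^'n \<Rightarrow> real^'n"
    and Df :: "real \<Rightarrow> real^'n \<Rightarrow> real^'n^'n"
    and Lf \<theta> :: real
  assumes y_init: "0 \<le> t \<Longrightarrow> y t t \<eta> = \<eta>"
    and y_deriv: "0 \<le> t \<Longrightarrow> 0 \<le> s \<Longrightarrow>
       ((\<lambda>s. y s t \<eta>) has_vector_derivative (A s *v y s t \<eta> + f s (y s t \<eta>))) (at s within {0..})"
    and f_lipschitz: "0 \<le> t \<Longrightarrow> N (f t x - f t z) \<le> Lf * exp (- \<theta> * t) * N (x - z)"
    and f_deriv: "0 \<le> t \<Longrightarrow> (f t has_derivative (*v) (Df t x)) (at x)"
    and Df_cont: "continuous_on ({0..} \<times> UNIV) (\<lambda>(t, x). Df t x)"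
    and Lf: "0 < Lf" and \<epsilon>: "0 \<le> \<epsilon>" "\<epsilon> < \<theta>"
begin

definition "flow_const = K0 * exp (Lf * K0 / (\<theta> - \<epsilon>))"

lemma flow_const_pos: "0 < flow_const"
  using K0 by (simp add: flow_const_def)

lemma continuous_on_flow: "0 \<le> t \<Longrightarrow> S \<subseteq> {0..} \<Longrightarrow> continuous_on S (\<lambda>s. y s t \<eta>)"
  by (rule continuous_on_subset[OF continuous_on_vector_derivative[OF y_deriv]]) auto

lemma inhomogeneous_solution_increment:
  assumes "0 \<le> t"
  shows "inhomogeneous_solution (\<lambda>u. f u (y u t x) - f u (y u t z)) (\<lambda>u. y u t x - y u t z)"
  unfolding inhomogeneous_solution_def
proof (intro allI impI)
  fix u :: real assume "0 \<le> u"
  show "((\<lambda>u. y u t x - y u t z) has_vector_derivative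
      A u *v (y u t x - y u t z) + (f u (y u t x) - f u (y u t z))) (at u within {0..})"
    using has_vector_derivative_diff[OF y_deriv[OF assms \<open>0 \<le> u\<close>] y_deriv[OF assms \<open>0 \<le> u\<close>], of x z]
    by (simp add: algebra_simps)
qed

lemma inhomogeneous_solution_increment_defect:
  assumes "0 \<le> t"
  shows "inhomogeneous_solution (\<lambda>u. increment_defect (\<lambda>p. f u (y u t p)) k x x' z z')
    (\<lambda>u. increment_defect (y u t) k x x' z z')"
  unfolding increment_defect_def
  by (intro inhomogeneous_solution_diff_scaleR inhomogeneous_solution_increment assms)

lemma flow_lipschitz:
  assumes "0 \<le> t" "0 \<le> s"
  shows "N (y s t x - y s t z) \<le> flow_const * exp (\<epsilon> * t + a * \<bar>s - t\<bar>) * N (x - z)"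
proof -
  have "N (y s t x - y s t z) \<le> flow_const * exp (a * \<bar>s - t\<bar>) * (exp (\<epsilon> * t) * N (y t t x - y t t z) + 0)"
    unfolding flow_const_def
  proof (rule perturbation_bound[OF inhomogeneous_solution_increment[OF assms(1)] assms])
    fix u assume "u \<in> closed_segment t s"
    then have "0 \<le> u" using closed_segment_subset_atLeast[OF assms] by auto
    then show "N (f u (y u t x) - f u (y u t z)) \<le> Lf * exp (- \<theta> * u) * (N (y u t x - y u t z) + 0)"
      using f_lipschitz by simp
  qed (use Lf \<epsilon> in auto)
  then show ?thesis by (simp add: y_init[OF assms(1)] exp_add mult_ac)
qed

lemma flow_lipschitz_bounded_time:
  assumes "0 \<le> t"
  obtains L where "0 < L" "\<And>s x z. s \<in> {0..T} \<Longrightarrow> N (y s t x - y s t z) \<le> L * N (x - z)"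
proof (rule that)
  let ?L = "flow_const * exp (\<epsilon> * t + a * (T + t))"
  show "0 < ?L" using flow_const_pos by simp
  fix s x z assume s: "s \<in> {0..T}"
  have "flow_const * exp (\<epsilon> * t + a * \<bar>s - t\<bar>) \<le> ?L"
    using s assms a flow_const_pos by auto
  then show "N (y s t x - y s t z) \<le> ?L * N (x - z)"
    using s by (intro order_trans[OF flow_lipschitz[OF assms]] mult_right_mono) auto
qed

definition "flow_remainder t \<eta> u p = f u (y u t p) - Df u (y u t \<eta>) *v y u t p"

lemma flow_remainder_lipschitz:
  assumes "0 \<le> t" "0 < e"
  obtains r where "0 < r"
    "\<And>u p p'. u \<in> {0..T} \<Longrightarrow> p \<in> N_ball \<eta> r \<Longrightarrow> p' \<in> N_ball \<eta> r \<Longrightarrow>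
      N (flow_remainder t \<eta> u p - flow_remainder t \<eta> u p') \<le> e * N (p - p')"
proof -
  let ?R = "flow_remainder t \<eta>"
  obtain C where C: "0 < C" "\<And>x. N x \<le> C * norm x" "\<And>x. norm x \<le> C * N x"
    using equivalent_to_norm by blast
  obtain L where L: "0 < L" "\<And>s x z. s \<in> {0..T} \<Longrightarrow> N (y s t x - y s t z) \<le> L * N (x - z)"
    using flow_lipschitz_bounded_time[OF \<open>0 \<le> t\<close>] by blast
  have norm_flow_le: "norm (y u t p - y u t p') \<le> C * L * N (p - p')" if "u \<in> {0..T}" for u p p'
    using order_trans[OF C(3) mult_left_mono[OF L(2)[OF that]]] C(1) by (simp add: mult.assoc)
  define e' where "e' = e / (C * (C * L))"
  have "0 < e'" using \<open>0 < e\<close> C(1) L(1) by (simp add: e'_def)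
  have Df_cont_T: "continuous_on ({0..T} \<times> UNIV) (\<lambda>(t, x). Df t x)"
    by (rule continuous_on_subset[OF Df_cont]) auto
  have flow_cont_T: "continuous_on {0..T} (\<lambda>u. y u t \<eta>)"
    by (rule continuous_on_flow[OF \<open>0 \<le> t\<close>]) simp
  obtain r where r: "0 < r"
    "\<And>u. u \<in> {0..T} \<Longrightarrow> e'-lipschitz_on (ball (y u t \<eta>) r) (\<lambda>x. f u x - Df u (y u t \<eta>) *v x)"
    by (rule uniformly_strict_derivative_compact[OF compact_Icc flow_cont_T f_deriv Df_cont_T \<open>0 < e'\<close>]) auto
  show ?thesis
  proof (rule that[of "r / (C * L)"])
    show "0 < r / (C * L)" using r(1) C(1) L(1) by simp
    fix u p p' assume u: "u \<in> {0..T}" and p: "p \<in> N_ball \<eta> (r / (C * L))" "p' \<in> N_ball \<eta> (r / (C * L))"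
    have near: "y u t q \<in> ball (y u t \<eta>) r" if "q \<in> N_ball \<eta> (r / (C * L))" for q
    proof -
      have "C * L * N (q - \<eta>) < r" using that C(1) L(1)
        by (simp add: N_ball_def pos_less_divide_eq mult.commute)
      then show ?thesis
        using norm_flow_le[OF u, of q \<eta>] by (simp add: dist_norm norm_minus_commute)
    qed
    have "N (?R u p - ?R u p') \<le> C * norm (?R u p - ?R u p')" by (rule C)
    also have "\<dots> \<le> C * (e' * (C * L * N (p - p')))"
      using lipschitz_onD[OF r(2)[OF u] near[OF p(1)] near[OF p(2)]] C(1) \<open>0 < e'\<close>
      by (intro mult_left_mono order_trans[OF _ mult_left_mono[OF norm_flow_le[OF u]]])
         (auto simp: flow_remainder_def dist_norm)
    also have "\<dots> = e * N (p - p')" using C(1) L(1) by (simp add: e'_def)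
    finally show "N (?R u p - ?R u p') \<le> e * N (p - p')" .
  qed
qed

text \<open>The forcing of the defect is the linearisation of \<open>f\<close> along the reference solution, applied to
  the defect itself, up to the defect of the nonlinear remainder.\<close>

lemma flow_forcing_increment_defect:
  assumes "0 \<le> t" "0 < e"
  obtains r where "0 < r"
    "\<And>k x x' z z' u. proportional_pairs (N_ball \<eta> r) k x x' z z' \<Longrightarrow> u \<in> {0..T} \<Longrightarrow>
      N (increment_defect (\<lambda>p. f u (y u t p)) k x x' z z')
        \<le> Lf * exp (- \<theta> * u) * (N (increment_defect (y u t) k x x' z z') + e * N (x - x'))"
proof -
  let ?R = "flow_remainder t \<eta>"
  define e' where "e' = Lf * exp (- \<theta> * T) * e / 2"
  have "0 < e'" using Lf \<open>0 < e\<close> by (simp add: e'_def)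
  then obtain r where "0 < r" and R: "\<And>u p p'. u \<in> {0..T} \<Longrightarrow> p \<in> N_ball \<eta> r \<Longrightarrow> p' \<in> N_ball \<eta> r \<Longrightarrow>
      N (?R u p - ?R u p') \<le> e' * N (p - p')"
    using flow_remainder_lipschitz[OF \<open>0 \<le> t\<close>, of e' T \<eta>] by blast
  show ?thesis
  proof (rule that[OF \<open>0 < r\<close>])
    fix k x x' z z' u
    assume "proportional_pairs (N_ball \<eta> r) k x x' z z'" and u: "u \<in> {0..T}"
    then have near: "x \<in> N_ball \<eta> r" "x' \<in> N_ball \<eta> r" "z \<in> N_ball \<eta> r" "z' \<in> N_ball \<eta> r"
      and k: "x - x' = k *\<^sub>R (z - z')"
      by (simp_all add: proportional_pairs_def)
    let ?E = "increment_defect (y u t) k x x' z z'" and ?B = "Df u (y u t \<eta>)"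
    let ?E\<^sub>R = "increment_defect (?R u) k x x' z z'"
    have "increment_defect (\<lambda>p. f u (y u t p)) k x x' z z' = ?B *v ?E + ?E\<^sub>R"
      by (simp add: increment_defect_def flow_remainder_def matrix_vector_mult_scaleR algebra_simps)
    then have "N (increment_defect (\<lambda>p. f u (y u t p)) k x x' z z') \<le> N (?B *v ?E) + N ?E\<^sub>R"
      by (simp only: N_add)
    also have "\<dots> \<le> Lf * exp (- \<theta> * u) * N ?E + Lf * exp (- \<theta> * u) * (e * N (x - x'))"
    proof (rule add_mono)
      show "N (?B *v ?E) \<le> Lf * exp (- \<theta> * u) * N ?E"
        by (rule N_derivative_le[OF f_deriv f_lipschitz]) (use u in auto)
      have "N ?E\<^sub>R \<le> 2 * e' * N (x - x')"
        by (intro N_increment_defect_le k R near u)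
      also have "\<dots> = Lf * exp (- \<theta> * T) * (e * N (x - x'))" by (simp add: e'_def)
      also have "\<dots> \<le> Lf * exp (- \<theta> * u) * (e * N (x - x'))"
        using Lf \<epsilon> u \<open>0 < e\<close> by (intro mult_right_mono mult_left_mono) auto
      finally show "N ?E\<^sub>R \<le> Lf * exp (- \<theta> * u) * (e * N (x - x'))" .
    qed
    finally show "N (increment_defect (\<lambda>p. f u (y u t p)) k x x' z z')
        \<le> Lf * exp (- \<theta> * u) * (N ?E + e * N (x - x'))"
      by (simp add: distrib_left)
  qed
qed

lemma flow_proportional_increments:
  assumes "0 \<le> t" "0 \<le> s"
  shows "proportional_increments (y s t) \<eta>"
proof (rule proportional_increments_N)
  fix e :: real assume "0 < e"
  define e' where "e' = e / (flow_const * exp (a * \<bar>s - t\<bar>))"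
  have "0 < e'" using \<open>0 < e\<close> flow_const_pos by (simp add: e'_def)
  then obtain r where "0 < r" and forcing: "\<And>k x x' z z' u. proportional_pairs (N_ball \<eta> r) k x x' z z' \<Longrightarrow>
      u \<in> {0..max s t} \<Longrightarrow> N (increment_defect (\<lambda>p. f u (y u t p)) k x x' z z')
        \<le> Lf * exp (- \<theta> * u) * (N (increment_defect (y u t) k x x' z z') + e' * N (x - x'))"
    using flow_forcing_increment_defect[OF \<open>0 \<le> t\<close>, of e' \<eta> "max s t"] by blast
  have "N (increment_defect (y s t) k x x' z z') \<le> e * N (x - x')"
    if pairs: "proportional_pairs (N_ball \<eta> r) k x x' z z'" for k x x' z z'
  proof -
    have "N (increment_defect (y s t) k x x' z z') \<le> flow_const * exp (a * \<bar>s - t\<bar>) *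
        (exp (\<epsilon> * t) * N (increment_defect (y t t) k x x' z z') + e' * N (x - x'))"
      unfolding flow_const_def
    proof (rule perturbation_bound[OF inhomogeneous_solution_increment_defect[OF \<open>0 \<le> t\<close>] assms])
      fix u assume "u \<in> closed_segment t s"
      then have "u \<in> {0..max s t}"
        using assms by (auto simp: closed_segment_eq_real_ivl split: if_splits)
      then show "N (increment_defect (\<lambda>p. f u (y u t p)) k x x' z z')
        \<le> Lf * exp (- \<theta> * u) * (N (increment_defect (y u t) k x x' z z') + e' * N (x - x'))"
        by (rule forcing[OF pairs])
    qed (use Lf \<epsilon> \<open>0 < e'\<close> in auto)
    also have "increment_defect (y t t) k x x' z z' = 0"
      using pairs by (simp add: increment_defect_def proportional_pairs_def y_init[OF \<open>0 \<le> t\<close>])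
    finally show ?thesis using flow_const_pos by (simp add: e'_def)
  qed
  then show "\<exists>r>0. \<forall>k x x' z z'. proportional_pairs (N_ball \<eta> r) k x x' z z' \<longrightarrow>
      N (increment_defect (y s t) k x x' z z') \<le> e * N (x - x')"
    using \<open>0 < r\<close> by blast
qed

lemma C1_map_flow: "0 \<le> t \<Longrightarrow> 0 \<le> s \<Longrightarrow> C1_map (y s t)"
  by (intro C1_map_proportional_increments flow_proportional_increments)

lemma C1_map_perturbation:
  assumes "0 \<le> t"
  shows "C1_map (f t)"
proof (rule C1_mapI[OF f_deriv[OF assms]])
  have "continuous_on UNIV (\<lambda>x. (\<lambda>(t, x). Df t x) (t, x))"
    using assms by (intro continuous_on_compose2[OF Df_cont] continuous_intros) auto
  then show "continuous_on UNIV (\<lambda>x. Df t x *v v)" for v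
    by (simp add: continuous_on_matrix_vector_mult continuous_on_const)
qed

end

section \<open>The dichotomy and the conjugacy\<close>

lemma has_integral_exp_minus_Icc:
  fixes k p q :: real
  assumes "k \<noteq> 0" "p \<le> q"
  shows "((\<lambda>s. exp (- k * s)) has_integral (exp (- k * p) - exp (- k * q)) / k) {p..q}"
proof -
  have "((\<lambda>s. exp (- k * s)) has_integral - exp (- k * q) / k - - exp (- k * p) / k) {p..q}"
    using assms by (intro fundamental_theorem_of_calculus)
      (auto intro!: derivative_eq_intros simp flip: has_real_derivative_iff_has_vector_derivative)
  then show ?thesis by (simp add: diff_divide_distrib)
qed

locale nonuniform_dichotomy = nonuniform_bounded_growth N A X K0 a \<epsilon>
  for N :: "real^'n \<Rightarrow> real" and A X K0 a \<epsilon> +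
  fixes P :: "real \<Rightarrow> real^'n^'n" and K \<alpha> \<mu> :: real
  assumes P_inv: "0 \<le> t \<Longrightarrow> 0 \<le> s \<Longrightarrow> P t ** evol X t s = evol X t s ** P s"
    and dich_stable: "0 \<le> s \<Longrightarrow> s \<le> t \<Longrightarrow> mnorm N (evol X t s ** P s) \<le> K * exp (- \<alpha> * (t - s) + \<mu> * s)"
    and dich_unstable: "0 \<le> t \<Longrightarrow> t \<le> s \<Longrightarrow>
      mnorm N (evol X t s ** (mat 1 - P s)) \<le> K * exp (\<alpha> * (t - s) + \<mu> * s)"
    and K: "1 \<le> K" and \<alpha>: "0 < \<alpha>"
begin

lemma green_bound:
  assumes "0 \<le> t" "0 \<le> s"
  shows "N (green X P t s *v h) \<le> K * exp (- \<alpha> * \<bar>s - t\<bar> + \<mu> * s) * N h"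
proof (cases "s \<le> t")
  case True
  then have "N (green X P t s *v h) \<le> mnorm N (evol X t s ** P s) * N h"
    by (simp add: green_def N_matrix_vector_mult_le)
  also have "\<dots> \<le> K * exp (- \<alpha> * (t - s) + \<mu> * s) * N h"
    using dich_stable[of s t] assms True by (intro mult_right_mono) auto
  finally show ?thesis using True by simp
next
  case False
  then have "green X P t s *v h = - ((evol X t s ** (mat 1 - P s)) *v h)"
    by (simp add: green_def bounded_bilinear.minus_left[OF bounded_bilinear_matrix_vector_mult])
  then have "N (green X P t s *v h) \<le> mnorm N (evol X t s ** (mat 1 - P s)) * N h"
    by (simp add: N_matrix_vector_mult_le)
  also have "\<dots> \<le> K * exp (\<alpha> * (t - s) + \<mu> * s) * N h"
    using dich_unstable[of t s] assms False by (intro mult_right_mono) auto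
  finally show ?thesis using False by (simp add: algebra_simps)
qed

text \<open>Invariance of the projector moves it to the fixed time \<open>t\<close>, so both branches of the Green
  function are continuous in \<open>s\<close> although \<open>P\<close> is not assumed to be.\<close>

lemma green_eq:
  assumes "0 \<le> t" "0 \<le> s"
  shows "green X P t s = (if s \<le> t then P t else P t - mat 1) ** evol X t s"
proof -
  interpret mm: bounded_bilinear "(**) :: real^'n^'n \<Rightarrow> real^'n^'n \<Rightarrow> real^'n^'n"
    by (rule bounded_bilinear_matrix_matrix_mult)
  show ?thesis by (simp add: green_def mm.diff_left mm.diff_right P_inv[OF assms])
qed

lemma measurable_green:
  assumes "0 \<le> t" and g: "continuous_on {0..} g"
  shows "(\<lambda>s. green X P t s *v g s) \<in> borel_measurable (lebesgue_on {0..})"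
proof -
  have branch: "(\<lambda>s. (B ** evol X t s) *v g s) \<in> borel_measurable (lebesgue_on {0..})" for B :: "real^'n^'n"
    by (intro continuous_imp_measurable_on_sets_lebesgue continuous_on_matrix_vector_mult g continuous_on_evol
        bounded_bilinear.continuous_on[OF bounded_bilinear_matrix_matrix_mult] continuous_on_const) simp
  have "{s \<in> space (lebesgue_on {0..}). s \<le> t} = {0..t}" by auto
  then have "{s \<in> space (lebesgue_on {0..}). s \<le> t} \<in> sets (lebesgue_on {0..})"
    by (simp add: sets_restrict_space_iff)
  then have "(\<lambda>s. if s \<le> t then (P t ** evol X t s) *v g s else ((P t - mat 1) ** evol X t s) *v g s)
      \<in> borel_measurable (lebesgue_on {0..})"
    by (rule measurable_If[OF branch branch])
  then show ?thesis
    by (rule measurable_cong[THEN iffD1, rotated]) (simp add: green_eq \<open>0 \<le> t\<close>)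
qed

lemma integrable_green:
  assumes "0 \<le> t" and g: "continuous_on {0..} g" "\<And>s. 0 \<le> s \<Longrightarrow> N (g s) \<le> M * exp (\<delta> * s)"
    and "\<delta> + \<mu> < \<alpha>"
  shows "(\<lambda>s. green X P t s *v g s) integrable_on {0..}"
proof -
  obtain C where C: "0 < C" "\<And>x. norm x \<le> C * N x" using norm_le_N by blast
  have "0 \<le> M" using order_trans[OF N_nonneg g(2)[of 0]] by simp
  show ?thesis
  proof (rule measurable_bounded_by_integrable_imp_integrable[OF measurable_green[OF \<open>0 \<le> t\<close> g(1)]])
    show "(\<lambda>s. C * K * M * exp (\<alpha> * t) * exp (- (\<alpha> - \<mu> - \<delta>) * s)) integrable_on {0..}"
      using \<open>\<delta> + \<mu> < \<alpha>\<close>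
      by (intro has_integral_integrable[OF has_integral_mult_right[OF has_integral_exp_minus_to_infinity]]) auto
    fix s :: real assume "s \<in> {0..}"
    then have s: "0 \<le> s" by simp
    have "- \<alpha> * \<bar>s - t\<bar> \<le> \<alpha> * t - \<alpha> * s"
      using \<alpha> mult_left_mono[of "s - t" "\<bar>s - t\<bar>" \<alpha>] by (simp add: algebra_simps)
    then have decay: "exp (- \<alpha> * \<bar>s - t\<bar> + \<mu> * s) * exp (\<delta> * s) \<le> exp (\<alpha> * t) * exp (- (\<alpha> - \<mu> - \<delta>) * s)"
      unfolding exp_add[symmetric] by (simp add: algebra_simps)
    have "norm (green X P t s *v g s) \<le> C * N (green X P t s *v g s)" by (rule C)
    also have "\<dots> \<le> C * (K * exp (- \<alpha> * \<bar>s - t\<bar> + \<mu> * s) * (M * exp (\<delta> * s)))"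
      using C(1) K g(2)[OF s] by (intro mult_left_mono order_trans[OF green_bound[OF \<open>0 \<le> t\<close> s]]) auto
    also have "\<dots> = C * K * M * (exp (- \<alpha> * \<bar>s - t\<bar> + \<mu> * s) * exp (\<delta> * s))" by (simp add: mult_ac)
    also have "\<dots> \<le> C * K * M * (exp (\<alpha> * t) * exp (- (\<alpha> - \<mu> - \<delta>) * s))"
      using decay C(1) K \<open>0 \<le> M\<close> by (intro mult_left_mono) auto
    finally show "norm (green X P t s *v g s) \<le> C * K * M * exp (\<alpha> * t) * exp (- (\<alpha> - \<mu> - \<delta>) * s)"
      by (simp add: mult_ac)
  qed simp
qed

end

locale dichotomous_perturbed_system =
  perturbed_linear_system N A X K0 a \<epsilon> f y Df Lf \<theta> + nonuniform_dichotomy N A X K0 a \<epsilon> P K \<alpha> \<mu>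
  for N :: "real^'n \<Rightarrow> real" and A X K0 a \<epsilon> f y Df Lf \<theta> P K \<alpha> \<mu> +
  fixes M \<delta> :: real
  assumes f_cont: "continuous_on ({0..} \<times> UNIV) (\<lambda>(t, x). f t x)"
    and f_bound: "0 \<le> t \<Longrightarrow> N (f t x) \<le> M * exp (\<delta> * t)"
    and forcing_rate: "\<delta> + \<mu> < \<alpha>"
    and past_rate: "\<mu> + \<alpha> - a < \<theta>" and future_rate: "\<mu> - (\<alpha> - a) < \<theta>"
begin

definition "conjugacy_integrand t s \<eta> = green X P t s *v f s (y s t \<eta>)"

definition "conjugacy_shift t \<eta> = integral {0..} (\<lambda>s. conjugacy_integrand t s \<eta>)"

definition "lip_kernel t s = K * Lf * flow_const * exp (\<epsilon> * t) * exp ((a - \<alpha>) * \<bar>s - t\<bar> + (\<mu> - \<theta>) * s)"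

definition "lip_const t = K * Lf * flow_const *
  (exp ((\<epsilon> + a - \<alpha>) * t) * ((1 - exp (- (\<theta> - (\<alpha> - a) - \<mu>) * t)) / (\<theta> - (\<alpha> - a) - \<mu>))
   + exp ((\<epsilon> + \<mu> - \<theta>) * t) / (\<theta> + (\<alpha> - a) - \<mu>))"

lemma integrable_conjugacy_integrand:
  assumes "0 \<le> t"
  shows "(\<lambda>s. conjugacy_integrand t s \<eta>) integrable_on {0..}"
  unfolding conjugacy_integrand_def
proof (rule integrable_green[OF assms _ f_bound forcing_rate])
  have "continuous_on {0..} (\<lambda>s. (\<lambda>(t, x). f t x) (s, y s t \<eta>))"
    by (intro continuous_on_compose2[OF f_cont] continuous_intros continuous_on_flow assms) auto
  then show "continuous_on {0..} (\<lambda>s. f s (y s t \<eta>))" by simp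
qed

lemma conjugacy_integrand_lipschitz:
  assumes "0 \<le> t" "0 \<le> s"
  shows "N (conjugacy_integrand t s x - conjugacy_integrand t s z) \<le> lip_kernel t s * N (x - z)"
proof -
  have "N (conjugacy_integrand t s x - conjugacy_integrand t s z)
      \<le> K * exp (- \<alpha> * \<bar>s - t\<bar> + \<mu> * s) * N (f s (y s t x) - f s (y s t z))"
    using green_bound[OF assms, of "f s (y s t x) - f s (y s t z)"]
    by (simp add: conjugacy_integrand_def matrix_vector_mult_diff_distrib)
  also have "\<dots> \<le> K * exp (- \<alpha> * \<bar>s - t\<bar> + \<mu> * s) *
      (Lf * exp (- \<theta> * s) * (flow_const * exp (\<epsilon> * t + a * \<bar>s - t\<bar>) * N (x - z)))"
    using K Lf flow_lipschitz[OF assms]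
    by (intro mult_left_mono order_trans[OF f_lipschitz[OF assms(2)]]) auto
  also have "\<dots> = K * Lf * flow_const *
      (exp (- \<alpha> * \<bar>s - t\<bar> + \<mu> * s) * exp (- \<theta> * s) * exp (\<epsilon> * t + a * \<bar>s - t\<bar>)) * N (x - z)"
    by (simp add: mult_ac)
  also have "exp (- \<alpha> * \<bar>s - t\<bar> + \<mu> * s) * exp (- \<theta> * s) * exp (\<epsilon> * t + a * \<bar>s - t\<bar>) =
      exp (\<epsilon> * t) * exp ((a - \<alpha>) * \<bar>s - t\<bar> + (\<mu> - \<theta>) * s)"
    unfolding exp_add[symmetric] by (simp add: algebra_simps)
  finally show ?thesis by (simp add: lip_kernel_def mult_ac)
qed

lemma has_integral_lip_kernel:
  assumes "0 \<le> t"
  shows "(lip_kernel t has_integral lip_const t) {0..}"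
proof -
  let ?C = "K * Lf * flow_const" and ?k = "\<theta> - (\<alpha> - a) - \<mu>" and ?l = "\<theta> + (\<alpha> - a) - \<mu>"
  have "((\<lambda>s. exp (- ?k * s)) has_integral (exp (- ?k * 0) - exp (- ?k * t)) / ?k) {0..t}"
    using past_rate assms by (intro has_integral_exp_minus_Icc) auto
  from has_integral_mult_right[OF this, of "?C * exp ((\<epsilon> + a - \<alpha>) * t)"]
  have past: "(lip_kernel t has_integral ?C * (exp ((\<epsilon> + a - \<alpha>) * t) * ((1 - exp (- ?k * t)) / ?k))) {0..t}"
    by (rule has_integral_eq[THEN has_integral_eq_rhs, rotated])
       (auto simp: lip_kernel_def exp_add[symmetric] algebra_simps)
  have "((\<lambda>s. exp (- ?l * s)) has_integral exp (- ?l * t) / ?l) {t..}"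
    using future_rate by (intro has_integral_exp_minus_to_infinity) simp
  from has_integral_mult_right[OF this, of "?C * exp ((\<epsilon> + \<alpha> - a) * t)"]
  have "(lip_kernel t has_integral ?C * (exp ((\<epsilon> + \<alpha> - a) * t) * exp (- ?l * t) / ?l)) {t..}"
    by (rule has_integral_eq[THEN has_integral_eq_rhs, rotated])
       (auto simp: lip_kernel_def exp_add[symmetric] algebra_simps)
  also have "exp ((\<epsilon> + \<alpha> - a) * t) * exp (- ?l * t) = exp ((\<epsilon> + \<mu> - \<theta>) * t)"
    unfolding exp_add[symmetric] by (simp add: algebra_simps)
  finally have future: "(lip_kernel t has_integral ?C * (exp ((\<epsilon> + \<mu> - \<theta>) * t) / ?l)) {t..}" .
  have "{0..t} \<inter> {t..} = {t}" "{0..t} \<union> {t..} = {0..}" using assms by auto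
  with has_integral_Un[OF past future] show ?thesis by (simp add: lip_const_def distrib_left)
qed

lemma conjugacy_shift_lipschitz:
  assumes "0 \<le> t"
  shows "N (conjugacy_shift t x - conjugacy_shift t z) \<le> lip_const t * N (x - z)"
proof (rule N_has_integral_le)
  show "((\<lambda>s. conjugacy_integrand t s x - conjugacy_integrand t s z) has_integral
      conjugacy_shift t x - conjugacy_shift t z) {0..}"
    unfolding conjugacy_shift_def
    by (intro has_integral_diff integrable_integral integrable_conjugacy_integrand assms)
  show "((\<lambda>s. lip_kernel t s * N (x - z)) has_integral lip_const t * N (x - z)) {0..}"
    by (intro has_integral_mult_left has_integral_lip_kernel assms)
qed (use conjugacy_integrand_lipschitz[OF assms] in auto)

lemma C1_map_conjugacy_shift:
  assumes "0 \<le> t"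
  shows "C1_map (conjugacy_shift t)"
proof -
  obtain C where C: "0 < C" "\<And>x. N x \<le> C * norm x" "\<And>x. norm x \<le> C * N x"
    using equivalent_to_norm by blast
  have "C1_map (\<lambda>\<eta>. integral {0..} (\<lambda>s. conjugacy_integrand t s \<eta>))"
  proof (rule C1_map_integral[OF integrable_conjugacy_integrand[OF assms]])
    fix s :: real assume "s \<in> {0..}"
    then have s: "0 \<le> s" by simp
    show "C1_map (conjugacy_integrand t s)"
      unfolding conjugacy_integrand_def
      by (intro C1_map_compose[OF C1_map_matrix_vector_mult]
          C1_map_compose[OF C1_map_perturbation C1_map_flow] assms s)
    fix x z
    have "0 \<le> lip_kernel t s" using K Lf flow_const_pos by (simp add: lip_kernel_def)
    have "norm (conjugacy_integrand t s x - conjugacy_integrand t s z)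
        \<le> C * N (conjugacy_integrand t s x - conjugacy_integrand t s z)" by (rule C)
    also have "\<dots> \<le> C * (lip_kernel t s * (C * norm (x - z)))"
      using C(1,2) \<open>0 \<le> lip_kernel t s\<close>
      by (intro mult_left_mono order_trans[OF conjugacy_integrand_lipschitz[OF assms s]]) auto
    finally show "norm (conjugacy_integrand t s x - conjugacy_integrand t s z)
        \<le> C * C * lip_kernel t s * norm (x - z)"
      by (simp add: mult_ac)
  next
    show "(\<lambda>s. C * C * lip_kernel t s) integrable_on {0..}"
      using has_integral_lip_kernel[OF assms] by (intro integrable_on_mult_right) auto
  qed
  then show ?thesis by (simp add: conjugacy_shift_def[abs_def])
qed

lemma C1_diffeo_conjugacy:
  assumes "0 \<le> t" "lip_const t < 1"
  shows "C1_diffeo (\<lambda>\<eta>. \<eta> - conjugacy_shift t \<eta>)"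
  using C1_map_conjugacy_shift[OF assms(1)] assms(2) conjugacy_shift_lipschitz[OF assms(1)]
  by (rule C1_diffeo_id_minus_contraction)

lemma eventually_lip_const_less_1:
  assumes "K * Lf * flow_const / (\<theta> + (\<alpha> - a) - \<mu>) < 1"
  shows "\<forall>\<^sub>F t in nhds 0. lip_const t < 1"
proof (rule order_tendstoD)
  have "isCont lip_const 0"
    unfolding lip_const_def[abs_def] using past_rate future_rate by (intro continuous_intros) auto
  then show "(lip_const \<longlongrightarrow> lip_const 0) (nhds 0)"
    by (simp add: isCont_def tendsto_at_iff_tendsto_nhds)
  show "lip_const 0 < 1" using assms by (simp add: lip_const_def)
qed

end

theorem theorem2:
  fixes N :: "real^'n \<Rightarrow> real"
    and A :: "real \<Rightarrow> real^'n^'n"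
    and f :: "real \<Rightarrow> real^'n \<Rightarrow> real^'n"
    and X :: "real \<Rightarrow> real^'n^'n"
    and P :: "real \<Rightarrow> real^'n^'n"
    and y :: "real \<Rightarrow> real \<Rightarrow> real^'n \<Rightarrow> real^'n"
    and K \<alpha> \<mu> K0 a \<epsilon> Lf \<theta> M \<delta> b c :: real
  assumes norm: "is_norm N"
    and A_cont: "continuous_on {0..} A"
    and f_cont: "continuous_on ({0..} \<times> UNIV) (\<lambda>(t, x). f t x)"
    and X_fund: "\<forall>t\<ge>0. invertible (X t) \<and> (X has_vector_derivative (A t ** X t)) (at t within {0..})"
    and y_sol: "\<forall>t\<ge>0. \<forall>\<eta>. y t t \<eta> = \<eta> \<and>
        (\<forall>s\<ge>0. ((\<lambda>s. y s t \<eta>) has_vector_derivative (A s *v y s t \<eta> + f s (y s t \<eta>))) (at s within {0..}))"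
    and y_unique: "\<forall>t\<ge>0. \<forall>\<eta>. \<forall>z. z t = \<eta> \<and>
        (\<forall>s\<ge>0. (z has_vector_derivative (A s *v z s + f s (z s))) (at s within {0..}))
        \<longrightarrow> (\<forall>s\<ge>0. z s = y s t \<eta>)"
    \<comment> \<open>nonuniform exponential dichotomy (K, alpha, mu) with projector P\<close>
    and K: "K \<ge> 1" and \<alpha>: "\<alpha> > 0" and \<mu>: "0 \<le> \<mu>" "\<mu> < \<alpha>"
    and P_proj: "\<forall>t\<ge>0. P t ** P t = P t"
    and P_inv: "\<forall>t\<ge>0. \<forall>s\<ge>0. P t ** evol X t s = evol X t s ** P s"
    and dich1: "\<forall>t s. 0 \<le> s \<and> s \<le> t \<longrightarrow> mnorm N (evol X t s ** P s) \<le> K * exp (- \<alpha> * (t - s) + \<mu> * s)"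
    and dich2: "\<forall>t s. 0 \<le> t \<and> t \<le> s \<longrightarrow> mnorm N (evol X t s ** (mat 1 - P s)) \<le> K * exp (\<alpha> * (t - s) + \<mu> * s)"
    \<comment> \<open>nonuniform bounded growth (K0, a, epsilon)\<close>
    and K0: "K0 \<ge> 1" and a: "a > 0" and \<epsilon>: "\<epsilon> \<ge> 0"
    and growth: "\<forall>t\<ge>0. \<forall>s\<ge>0. mnorm N (evol X t s) \<le> K0 * exp (a * \<bar>t - s\<bar> + \<epsilon> * s)"
    \<comment> \<open>(P1), (P2), (P3)\<close>
    and Lf: "Lf > 0" and \<theta>: "\<theta> \<ge> 0"
    and P1: "\<forall>t\<ge>0. \<forall>y1 y2. N (f t y1 - f t y2) \<le> Lf * exp (- \<theta> * t) * N (y1 - y2)"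
    and M: "M > 0" and \<delta>: "\<delta> \<ge> 0"
    and P2: "\<forall>t\<ge>0. \<forall>x. N (f t x) \<le> M * exp (\<delta> * t)"
    and P3: "\<exists>Df :: real \<Rightarrow> real^'n \<Rightarrow> real^'n^'n.
        (\<forall>t\<ge>0. \<forall>x. (f t has_derivative (\<lambda>h. Df t x *v h)) (at x))
        \<and> continuous_on ({0..} \<times> UNIV) (\<lambda>(t, x). Df t x)"
    \<comment> \<open>conditions on b\<close>
    and b: "b > 0"
    and c1: "\<delta> + \<mu> < min b \<alpha>"
    and c2: "\<mu> \<le> \<theta>" "\<epsilon> < \<theta>" "\<alpha> + \<mu> - \<theta> + b > 0" "\<alpha> - \<mu> + \<theta> - b > 0"
    and c3: "K * Lf / (\<alpha> + \<mu> - \<theta> + b) + K * Lf / (\<alpha> - \<mu> + \<theta> - b) < 1"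
    \<comment> \<open>additional conditions\<close>
    and c4: "max (\<mu> + \<alpha> - a) (\<mu> - (\<alpha> - a)) < \<theta>"
    and c5: "\<mu> + \<epsilon> \<le> \<theta>"
    and c: "c > 2"
    and c6: "K * Lf * K0 * exp (Lf * K0 / (\<theta> - \<epsilon>))
        * max (1 / (\<theta> - (\<alpha> - a) - \<mu>)) (1 / (\<theta> + (\<alpha> - a) - \<mu>)) \<le> 1 / c"
  shows "\<exists>tc :: ereal. tc > 0 \<and>
    (\<forall>t. 0 \<le> t \<and> ereal t < tc \<longrightarrow>
       C1_diffeo (\<lambda>\<eta>. \<eta> - integral {0..} (\<lambda>s. green X P t s *v f s (y s t \<eta>))))"
proof -
  obtain Df where "\<forall>t\<ge>0. \<forall>x. (f t has_derivative (\<lambda>h. Df t x *v h)) (at x)"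
    and "continuous_on ({0..} \<times> UNIV) (\<lambda>(t, x). Df t x)"
    using P3 by blast
  then interpret dichotomous_perturbed_system N A X K0 a \<epsilon> f y Df Lf \<theta> P K \<alpha> \<mu> M \<delta>
    using norm X_fund y_sol P_inv dich1 dich2 growth P1 P2 f_cont K \<alpha> K0 a \<epsilon> Lf c1 c2(2) c4
    by unfold_locales simp_all
  let ?past = "1 / (\<theta> - (\<alpha> - a) - \<mu>)" and ?future = "1 / (\<theta> + (\<alpha> - a) - \<mu>)"
  have "K * Lf * flow_const * ?future \<le> K * Lf * flow_const * max ?past ?future"
    using K Lf flow_const_pos by (intro mult_left_mono) auto
  also have "\<dots> \<le> 1 / c" using c6 by (simp add: flow_const_def mult.assoc)
  also have "\<dots> < 1" using c by simp
  finally have "\<forall>\<^sub>F t in nhds 0. lip_const t < 1"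
    by (intro eventually_lip_const_less_1) simp
  then obtain d where "0 < d" and d: "\<And>t. dist t 0 < d \<Longrightarrow> lip_const t < 1"
    unfolding eventually_nhds_metric by blast
  have "C1_diffeo (\<lambda>\<eta>. \<eta> - integral {0..} (\<lambda>s. green X P t s *v f s (y s t \<eta>)))" if "0 \<le> t" "t < d" for t
    using C1_diffeo_conjugacy[OF \<open>0 \<le> t\<close> d] that
    by (simp add: conjugacy_shift_def conjugacy_integrand_def)
  then show ?thesis using \<open>0 < d\<close> by (intro exI[of _ "ereal d"]) auto
qed

end
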